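(* Let $a,b,m,n$ be integers with $a,b\ge 2$, $m\ge a+1$, $n\ge b+1$. The generic birigidity matroid $\mathrm{BR}_{a,b}(m,n)$ is the freest linearly representable abstract $(a,b)$-birigidity matroid on $[m]\times[n]$; that is, $\mathrm{BR}_{a,b}(m,n)$ is itself a linearly representable abstract $(a,b)$-birigidity matroid on $[m]\times[n]$, and every abstract $(a,b)$-birigidity matroid $M$ on $[m]\times[n]$ that is representable over some field satisfies $M\preceq \mathrm{BR}_{a,b}(m,n)$. Moreover, every abstract $(a,b)$-birigidity matroid $M$ on $[m]\times [n]$ that is representable over a field $\mathbb F$ admits a representation by a standard birigidity matrix over the same field: there are vectors $u_i\in\mathbb F^a$ ($i\in[m]$) and $v_j\in\mathbb F^b$ ($j\in[n]$) such that $M$ is the column matroid of $\mathcal R_{a,b}(u,v)$.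
   Context: Elements $(i,j)$ of $[m]\times[n]$ are written $ij$ (edges of the complete bipartite graph $K_{m,n}$). Weak order: for matroids $M,N$ on a common ground set, $M\preceq N$ ("$N$ is freer than $M$") means that every independent set of $M$ is independent in $N$. A matroid is linearly representable if it is representable over some field. An abstract $(a,b)$-birigidity matroid on $[m]\times[n]$ is a matroid $M$ with ground set $[m]\times[n]$ such that (1) $\operatorname{rank} M = mn-(m-a)(n-b)=an+bm-ab$; (2) for every $A\subseteq[m]$ and $D\subseteq[n]$ with $|A|=a+1$, $|D|=b+1$, the set $A\times D$ is a circuit of $M$. Standard birigidity matrix: for a field $\mathbb F$, vectors $u_i=(u_{i,1},\dots,u_{i,a})\in\mathbb F^a$ ($i\in[m]$) and $v_j=(v_{j,1},\dots,v_{j,b})\in\mathbb F^b$ ($j\in[n]$), the matrix $\mathcal R_{a,b}(u,v)$ is the $(bm+an)\times mn$ matrix with columns indexed by $ij\in[m]\times[n]$ and rows labelled $U_{i,q}$ ($i\in[m]$, $q\in[b]$) and $V_{p,j}$ ($p\in[a]$, $j\in[n]$), in which the column indexed by $ij$ has entry $v_{j,q}$ in row $U_{i,q}$ ($1\le q\le b$), entry $u_{i,p}$ in row $V_{p,j}$ ($1\le p\le a$), and all other entries $0$. Generic birigidity matroid: let $X_{i,r}$ ($i\in[m]$, $r\in[a]$) and $Y_{j,s}$ ($j\in[n]$, $s\in[b]$) be jointly algebraically independent indeterminates over $\mathbb Q$, and put $\mathbf X_i=(X_{i,1},\dots,X_{i,a})$, $\mathbf Y_j=(Y_{j,1},\dots,Y_{j,b})$.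 Then $\mathrm{BR}_{a,b}(m,n)$ is the column matroid of $\mathcal R_{a,b}(\mathbf X,\mathbf Y)$ over the rational function field $\mathbb Q(X_{i,r},Y_{j,s})$. *)

theory Defs
  imports
    Complex_Main
    "HOL-Library.Poly_Mapping"
    "HOL-Library.Nat_Bijection"
    "HOL-Computational_Algebra.Fraction_Field"
begin

section \<open>Matroids\<close>

text \<open>A matroid on a ground set \<open>E\<close> is given by its family \<open>M\<close> of independent sets. Two matroids on
  the same ground set are equal iff these families are.\<close>

definition matroid :: "'e set \<Rightarrow> 'e set set \<Rightarrow> bool" where
  "matroid E M \<longleftrightarrow>
     finite E \<and> (\<forall>I\<in>M. I \<subseteq> E) \<and> {} \<in> M \<and>
     (\<forall>I\<in>M. \<forall>J. J \<subseteq> I \<longrightarrow> J \<in> M) \<and>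
     (\<forall>I\<in>M. \<forall>J\<in>M. card I < card J \<longrightarrow> (\<exists>x\<in>J - I. insert x I \<in> M))"

definition matroid_rank :: "'e set set \<Rightarrow> nat" where
  "matroid_rank M = Max (card ` M)"

definition circuit :: "'e set \<Rightarrow> 'e set set \<Rightarrow> 'e set \<Rightarrow> bool" where
  "circuit E M C \<longleftrightarrow> C \<subseteq> E \<and> C \<notin> M \<and> (\<forall>D. D \<subset> C \<longrightarrow> D \<in> M)"

text \<open>\<open>M \<preceq> N\<close>: \<open>N\<close> is freer than \<open>M\<close> (for matroids on a common ground set).\<close>

definition weak_order :: "'e set set \<Rightarrow> 'e set set \<Rightarrow> bool" (infix \<open>\<preceq>\<close> 50) where
  "M \<preceq> N \<longleftrightarrow> (\<forall>I\<in>M. I \<in> N)"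

section \<open>Linear representations\<close>

text \<open>Fields are subfields \<open>K\<close> of a type \<open>'f\<close> of class \<^class>\<open>field\<close>; \<open>K = UNIV\<close> is \<open>'f\<close> itself.
  The parameter is there so that a rational function field in finitely many indeterminates, whose
  number depends on \<open>a, b, m, n\<close> and thus cannot be built into a type, can be named.

  A matrix is a function of a row label and a column label, together with the set \<open>R\<close> of rows and
  the set \<open>E\<close> of columns that are meant. Independence below is independence of the family of
  columns, so that equal columns with different labels are dependent.\<close>

definition column_matroid :: "'f::field set \<Rightarrow> 'r set \<Rightarrow> 'e set \<Rightarrow> ('r \<Rightarrow> 'e \<Rightarrow> 'f) \<Rightarrow> 'e set set" where
  "column_matroid K R E A =
     {I. I \<subseteq> E \<and>
         (\<forall>c. (\<forall>e\<in>I. c e \<in> K) \<and> (\<forall>r\<in>R. (\<Sum>e\<in>I. c e * A r e) = 0) \<longrightarrow> (\<forall>e\<in>I. c e = 0))}"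

definition representable_over :: "'f::field set \<Rightarrow> 'e set \<Rightarrow> 'e set set \<Rightarrow> bool" where
  "representable_over K E M \<longleftrightarrow>
     (\<exists>(d::nat) A. (\<forall>r<d. \<forall>e\<in>E. A r e \<in> K) \<and> M = column_matroid K {..<d} E A)"

section \<open>Birigidity matroids\<close>

abbreviation bigraph_edges :: "nat \<Rightarrow> nat \<Rightarrow> (nat \<times> nat) set" where
  "bigraph_edges m n \<equiv> {1..m} \<times> {1..n}"

definition abstract_birigidity ::
    "nat \<Rightarrow> nat \<Rightarrow> nat \<Rightarrow> nat \<Rightarrow> (nat \<times> nat) set set \<Rightarrow> bool" where
  "abstract_birigidity a b m n M \<longleftrightarrow>
     matroid (bigraph_edges m n) M \<and>
     int (matroid_rank M) = int m * int n - (int m - int a) * (int n - int b) \<and>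
     (\<forall>A D. A \<subseteq> {1..m} \<and> D \<subseteq> {1..n} \<and> card A = a + 1 \<and> card D = b + 1 \<longrightarrow>
        circuit (bigraph_edges m n) M (A \<times> D))"

text \<open>Row labels: \<open>URow i q\<close> is \<open>U\<^sub>i\<^sub>,\<^sub>q\<close> and \<open>VRow p j\<close> is \<open>V\<^sub>p\<^sub>,\<^sub>j\<close>.\<close>

datatype row_label = URow nat nat | VRow nat nat

definition birigidity_rows :: "nat \<Rightarrow> nat \<Rightarrow> nat \<Rightarrow> nat \<Rightarrow> row_label set" where
  "birigidity_rows a b m n =
     {URow i q | i q. i \<in> {1..m} \<and> q \<in> {1..b}} \<union> {VRow p j | p j. p \<in> {1..a} \<and> j \<in> {1..n}}"

text \<open>A vector \<open>u\<^sub>i \<in> F\<^sup>a\<close> is the function \<open>u i\<close> on \<open>{1..a}\<close>, and likewise \<open>v\<^sub>j \<in> F\<^sup>b\<close>; values outside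
  the index ranges do not occur in the rows and columns selected by \<^const>\<open>birigidity_rows\<close> and
  \<^const>\<open>bigraph_edges\<close>.\<close>

fun birigidity_matrix ::
    "(nat \<Rightarrow> nat \<Rightarrow> 'f::field) \<Rightarrow> (nat \<Rightarrow> nat \<Rightarrow> 'f) \<Rightarrow> row_label \<Rightarrow> nat \<times> nat \<Rightarrow> 'f" where
  "birigidity_matrix u v (URow i' q) (i, j) = (if i' = i then v j q else 0)"
| "birigidity_matrix u v (VRow p j') (i, j) = (if j' = j then u i p else 0)"

definition birigidity_column_matroid ::
    "'f::field set \<Rightarrow> nat \<Rightarrow> nat \<Rightarrow> nat \<Rightarrow> nat \<Rightarrow> (nat \<Rightarrow> nat \<Rightarrow> 'f) \<Rightarrow> (nat \<Rightarrow> nat \<Rightarrow> 'f)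
      \<Rightarrow> (nat \<times> nat) set set" where
  "birigidity_column_matroid K a b m n u v =
     column_matroid K (birigidity_rows a b m n) (bigraph_edges m n) (birigidity_matrix u v)"

section \<open>The generic birigidity matroid\<close>

text \<open>Rational functions over the rationals in countably many indeterminates \<open>x\<^sub>0, x\<^sub>1, \<dots>\<close>, two disjoint
  families of which are renamed \<open>X\<^sub>i\<^sub>,\<^sub>r\<close> and \<open>Y\<^sub>j\<^sub>,\<^sub>s\<close> by means of injective codings into \<^typ>\<open>nat\<close>.\<close>

type_synonym ratfun = "((nat \<Rightarrow>\<^sub>0 nat) \<Rightarrow>\<^sub>0 rat) fract"

definition indet :: "nat \<Rightarrow> ratfun" where
  "indet k = Fract (Poly_Mapping.single (Poly_Mapping.single k 1) 1) 1"

definition X_indet :: "nat \<Rightarrow> nat \<Rightarrow> ratfun" where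
  "X_indet i r = indet (sum_encode (Inl (prod_encode (i, r))))"

definition Y_indet :: "nat \<Rightarrow> nat \<Rightarrow> ratfun" where
  "Y_indet j s = indet (sum_encode (Inr (prod_encode (j, s))))"

inductive_set generated_field :: "'f::field set \<Rightarrow> 'f set" for S where
  base: "x \<in> S \<Longrightarrow> x \<in> generated_field S"
| one: "1 \<in> generated_field S"
| diff: "x \<in> generated_field S \<Longrightarrow> y \<in> generated_field S \<Longrightarrow> x - y \<in> generated_field S"
| mult: "x \<in> generated_field S \<Longrightarrow> y \<in> generated_field S \<Longrightarrow> x * y \<in> generated_field S"
| inverse: "x \<in> generated_field S \<Longrightarrow> inverse x \<in> generated_field S"

text \<open>The field of rational functions in exactly the indeterminates \<open>X\<^sub>i\<^sub>,\<^sub>r\<close> (\<open>1 \<le> i \<le> m\<close>, \<open>1 \<le> r \<le> a\<close>) and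
  \<open>Y\<^sub>j\<^sub>,\<^sub>s\<close> (\<open>1 \<le> j \<le> n\<close>, \<open>1 \<le> s \<le> b\<close>); the rationals are included since they form the prime field.\<close>

definition generic_field :: "nat \<Rightarrow> nat \<Rightarrow> nat \<Rightarrow> nat \<Rightarrow> ratfun set" where
  "generic_field a b m n =
     generated_field ({X_indet i r | i r. i \<in> {1..m} \<and> r \<in> {1..a}} \<union>
                      {Y_indet j s | j s. j \<in> {1..n} \<and> s \<in> {1..b}})"

definition generic_birigidity_matroid ::
    "nat \<Rightarrow> nat \<Rightarrow> nat \<Rightarrow> nat \<Rightarrow> (nat \<times> nat) set set" where
  "generic_birigidity_matroid a b m n =
     birigidity_column_matroid (generic_field a b m n) a b m n X_indet Y_indet"

end

theory Submission
  imports Defs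
begin

text \<open>Let \<open>M\<close> be a represented abstract birigidity matroid and let \<open>c\<^sub>i\<^sub>j\<close>, for \<open>i > a\<close> and \<open>j > b\<close>, be the
  linear relation of the circuit \<open>({1..a} \<union> {i}) \<times> ({1..b} \<union> {j})\<close>. By the rank condition the \<open>c\<^sub>i\<^sub>j\<close> form a
  basis of all linear relations. The circuits obtained by exchanging an element of \<open>{1..a}\<close> for a
  second \<open>k > a\<close> force \<open>c\<^sub>i\<^sub>j\<close> and \<open>c\<^sub>k\<^sub>j\<close> to be proportional on each row \<open>p \<le> a\<close>, and symmetrically for columns.
  This is enough to turn every \<open>c\<^sub>i\<^sub>j\<close>, after rescaling the columns of the representation, into a
  tensor product \<open>\<alpha>\<^sub>i \<otimes> \<beta>\<^sub>j\<close>. The space of relations is then a tensor product as well, which is the kernel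
  of a standard birigidity matrix.

  Independent columns of a standard birigidity matrix over any field remain independent for
  indeterminates, by specializing polynomials with integer coefficients. Hence the generic matroid
  is freer than every representable \<open>M\<close>; and special choices of \<open>u\<close> and \<open>v\<close> provide the independent
  sets that make it an abstract birigidity matroid.\<close>

section \<open>Linear relations over a subfield\<close>

text \<open>Modelled on the rules of \<open>generated_field\<close>. Coefficients are tracked
  through such a \<open>K\<close> because \<open>generic_birigidity_matroid\<close> admits only
  combinations over \<open>generic_field\<close>, so every elimination must stay inside it.\<close>

definition subfield_set :: "'f::field set \<Rightarrow> bool" where
  "subfield_set K \<longleftrightarrow> 1 \<in> K \<and> (\<forall>x\<in>K. \<forall>y\<in>K. x - y \<in> K \<and> x * y \<in> K) \<and> (\<forall>x\<in>K. inverse x \<in> K)"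

lemma subfield_set_UNIV: "subfield_set UNIV"
  by (simp add: subfield_set_def)

lemma subfield_set_generated_field: "subfield_set (generated_field S)"
  unfolding subfield_set_def
  by (auto intro: generated_field.intros)

context
  fixes K :: "'f::field set"
  assumes K: "subfield_set K"
begin

lemma subfield_set_one: "1 \<in> K"
  and subfield_set_diff: "x \<in> K \<Longrightarrow> y \<in> K \<Longrightarrow> x - y \<in> K"
  and subfield_set_mult: "x \<in> K \<Longrightarrow> y \<in> K \<Longrightarrow> x * y \<in> K"
  and subfield_set_inverse: "x \<in> K \<Longrightarrow> inverse x \<in> K"
  using K by (auto simp: subfield_set_def)

lemma subfield_set_zero: "0 \<in> K"
  using subfield_set_diff[OF subfield_set_one subfield_set_one] by simp

lemma subfield_set_uminus: "x \<in> K \<Longrightarrow> - x \<in> K"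
  using subfield_set_diff[OF subfield_set_zero] by simp

lemma subfield_set_add: "x \<in> K \<Longrightarrow> y \<in> K \<Longrightarrow> x + y \<in> K"
  using subfield_set_diff[OF _ subfield_set_uminus] by force

lemma subfield_set_divide: "x \<in> K \<Longrightarrow> y \<in> K \<Longrightarrow> x / y \<in> K"
  by (simp add: divide_inverse subfield_set_mult subfield_set_inverse)

lemma subfield_set_sum: "(\<And>x. x \<in> A \<Longrightarrow> f x \<in> K) \<Longrightarrow> sum f A \<in> K"
  by (induction A rule: infinite_finite_induct) (auto simp: subfield_set_zero subfield_set_add)

lemmas subfield_set_closed =
  subfield_set_zero subfield_set_one subfield_set_diff subfield_set_mult subfield_set_inverse
  subfield_set_uminus subfield_set_add subfield_set_divide subfield_set_sum

text \<open>Gaussian elimination by induction on the equations \<open>I\<close>: solve one equation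
  for an unknown that occurs in it and substitute into the others. Only field operations of
  \<open>K\<close> occur.\<close>

lemma homogeneous_system_nontrivial_solution:
  assumes "finite I" and "finite J" and "card I < card J"
    and "\<And>e x. e \<in> I \<Longrightarrow> x \<in> J \<Longrightarrow> D e x \<in> K"
  shows "\<exists>c. (\<forall>x\<in>J. c x \<in> K) \<and> (\<exists>x\<in>J. c x \<noteq> 0) \<and> (\<forall>e\<in>I. (\<Sum>x\<in>J. c x * D e x) = 0)"
  using assms
proof (induction I arbitrary: J D rule: finite_induct)
  case empty
  then obtain x where "x \<in> J" by (metis card_gt_0_iff all_not_in_conv card.empty)
  then show ?case
    by (intro exI[of _ "\<lambda>_. 1"]) (auto simp: subfield_set_one)
next
  case (insert e I)
  show ?case
  proof (cases "\<forall>x\<in>J. D e x = 0")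
    case True
    have "\<exists>c. (\<forall>x\<in>J. c x \<in> K) \<and> (\<exists>x\<in>J. c x \<noteq> 0) \<and> (\<forall>e\<in>I. (\<Sum>x\<in>J. c x * D e x) = 0)"
      using insert by (intro insert.IH) auto
    then show ?thesis using True by auto
  next
    case False
    then obtain y where y: "y \<in> J" "D e y \<noteq> 0" by blast
    \<comment> \<open>The remaining equations after the unknown \<open>y\<close> has been eliminated
      by means of equation \<open>e\<close>.\<close>
    define D' where "D' f x = D f x - D f y * D e x / D e y" for f x
    have "\<exists>c. (\<forall>x\<in>J - {y}. c x \<in> K) \<and> (\<exists>x\<in>J - {y}. c x \<noteq> 0) \<and>
        (\<forall>e\<in>I. (\<Sum>x\<in>J - {y}. c x * D' e x) = 0)"
      using insert.prems insert.hyps y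
      by (intro insert.IH) (auto simp: D'_def intro!: subfield_set_closed)
    then obtain c where cK: "\<forall>x\<in>J - {y}. c x \<in> K" and nz: "\<exists>x\<in>J - {y}. c x \<noteq> 0"
      and c: "\<forall>e\<in>I. (\<Sum>x\<in>J - {y}. c x * D' e x) = 0" by blast
    \<comment> \<open>Equation \<open>e\<close> forces the value \<open>- s\<close> on the unknown
      \<open>y\<close>.\<close>
    define s where "s = (\<Sum>x\<in>J - {y}. c x * D e x) / D e y"
    define c' where "c' = c(y := - s)"
    have split: "(\<Sum>x\<in>J. c' x * D f x) = - s * D f y + (\<Sum>x\<in>J - {y}. c x * D f x)" for f
      using y(1) insert.prems(1) by (simp add: c'_def sum.remove)
    have sK: "s \<in> K"
      unfolding s_def using cK y(1) insert.prems(3) by (auto intro!: subfield_set_closed)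
    have "(\<Sum>x\<in>J. c' x * D f x) = 0" if "f \<in> insert e I" for f
    proof (cases "f = e")
      case True
      then show ?thesis unfolding split using y by (simp add: s_def)
    next
      case False
      then have "(\<Sum>x\<in>J - {y}. c x * D' f x) = 0" using that c by blast
      moreover have "(\<Sum>x\<in>J - {y}. c x * D' f x) = (\<Sum>x\<in>J - {y}. c x * D f x) - s * D f y"
        by (simp add: D'_def s_def algebra_simps sum_subtractf sum_distrib_left sum_divide_distrib)
      ultimately show ?thesis unfolding split by simp
    qed
    moreover have "\<forall>x\<in>J. c' x \<in> K" using cK sK by (auto simp: c'_def subfield_set_uminus)
    moreover have "\<exists>x\<in>J. c' x \<noteq> 0" using nz by (auto simp: c'_def)
    ultimately show ?thesis by blast
  qed
qed

lemma in_column_matroidD: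
  assumes "I \<in> column_matroid K R E A" and "\<And>e. e \<in> I \<Longrightarrow> c e \<in> K"
    and "\<And>r. r \<in> R \<Longrightarrow> (\<Sum>e\<in>I. c e * A r e) = 0" and "e \<in> I"
  shows "c e = 0"
  using assms unfolding column_matroid_def by blast

text \<open>Exchange bound: if \<open>J\<close> were larger than \<open>I\<close>, the matrix of
  spanning coefficients would have more columns than rows, and a nontrivial vector in its kernel
  would be a dependency of \<open>J\<close>.\<close>

lemma card_le_of_spanned:
  assumes J: "J \<in> column_matroid K R E A" and fin: "finite I" "finite J"
    and sp: "\<And>x. x \<in> J \<Longrightarrow> \<exists>d. (\<forall>e\<in>I. d e \<in> K) \<and> (\<forall>r\<in>R. A r x = (\<Sum>e\<in>I. d e * A r e))"
  shows "card J \<le> card I"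
proof (rule ccontr)
  assume *: "\<not> card J \<le> card I"
  have "\<forall>x\<in>J. \<exists>d. (\<forall>e\<in>I. d e \<in> K) \<and> (\<forall>r\<in>R. A r x = (\<Sum>e\<in>I. d e * A r e))"
    using sp by blast
  then obtain d where dK: "\<And>x e. x \<in> J \<Longrightarrow> e \<in> I \<Longrightarrow> d x e \<in> K"
    and d: "\<And>x r. x \<in> J \<Longrightarrow> r \<in> R \<Longrightarrow> A r x = (\<Sum>e\<in>I. d x e * A r e)"
    by (auto dest!: bchoice)
  obtain c where cK: "\<forall>x\<in>J. c x \<in> K" and nz: "\<exists>x\<in>J. c x \<noteq> 0"
    and c: "\<forall>e\<in>I. (\<Sum>x\<in>J. c x * d x e) = 0"
    using homogeneous_system_nontrivial_solution[OF fin, of "\<lambda>e x. d x e"] * dK by auto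
  have "(\<Sum>x\<in>J. c x * A r x) = 0" if "r \<in> R" for r
  proof -
    have "(\<Sum>x\<in>J. c x * A r x) = (\<Sum>x\<in>J. \<Sum>e\<in>I. c x * d x e * A r e)"
      using that by (intro sum.cong) (auto simp: d sum_distrib_left mult.assoc)
    also have "\<dots> = (\<Sum>e\<in>I. (\<Sum>x\<in>J. c x * d x e) * A r e)"
      by (subst sum.swap) (simp add: sum_distrib_right)
    finally show ?thesis using c by simp
  qed
  then have "\<forall>x\<in>J. c x = 0" using in_column_matroidD[OF J] cK by blast
  then show False using nz by blast
qed

lemma spanned_if_not_independent:
  assumes I: "I \<in> column_matroid K R E A" and fin: "finite I"
    and x: "x \<in> E" "x \<notin> I" "insert x I \<notin> column_matroid K R E A"
  shows "\<exists>d. (\<forall>e\<in>I. d e \<in> K) \<and> (\<forall>r\<in>R. A r x = (\<Sum>e\<in>I. d e * A r e))"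
proof -
  have "insert x I \<subseteq> E" using I x by (auto simp: column_matroid_def)
  with x(3) obtain c where cK: "\<forall>e\<in>insert x I. c e \<in> K"
    and c: "\<forall>r\<in>R. (\<Sum>e\<in>insert x I. c e * A r e) = 0" and nz: "\<exists>e\<in>insert x I. c e \<noteq> 0"
    unfolding column_matroid_def by blast
  have c: "c x * A r x + (\<Sum>e\<in>I. c e * A r e) = 0" if "r \<in> R" for r
    using c that x(2) fin by simp
  have cx: "c x \<noteq> 0"
  proof
    assume "c x = 0"
    then have "\<forall>e\<in>I. c e = 0" using in_column_matroidD[OF I] c cK by auto
    then show False using nz \<open>c x = 0\<close> by auto
  qed
  show ?thesis
  proof (intro exI conjI ballI)
    show "- c e / c x \<in> K" if "e \<in> I" for e
      using that cK by (auto intro!: subfield_set_closed)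
    show "A r x = (\<Sum>e\<in>I. - c e / c x * A r e)" if "r \<in> R" for r
      using c[OF that] cx
      by (simp add: field_simps sum_negf eq_neg_iff_add_eq_0 flip: sum_divide_distrib)
  qed
qed

text \<open>Subsets inherit independence because a dependency extends by zero. For augmentation, if
  no element of \<open>J\<close> extends \<open>I\<close>, then \<open>I\<close> spans
  \<open>J\<close>, and the exchange bound contradicts the cardinalities.\<close>

lemma matroid_column_matroid:
  assumes "finite E"
  shows "matroid E (column_matroid K R E A)"
  unfolding matroid_def
proof (intro conjI ballI allI impI)
  fix I J assume I: "I \<in> column_matroid K R E A" and JI: "J \<subseteq> I"
  have fin: "finite I" using I assms by (auto simp: column_matroid_def intro: finite_subset)
  have "\<forall>e\<in>J. c e = 0"
    if "\<forall>e\<in>J. c e \<in> K" and 0: "\<forall>r\<in>R. (\<Sum>e\<in>J. c e * A r e) = 0" for c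
  proof -
    define c' where "c' e = (if e \<in> J then c e else 0)" for e
    have "(\<Sum>e\<in>I. c' e * A r e) = (\<Sum>e\<in>J. c e * A r e)" for r
      using fin JI by (intro sum.mono_neutral_cong_right) (auto simp: c'_def)
    then have "\<forall>e\<in>I. c' e = 0"
      using in_column_matroidD[OF I, of c'] that subfield_set_zero by (auto simp: c'_def)
    then show ?thesis using JI by (metis c'_def subsetD)
  qed
  then show "J \<in> column_matroid K R E A"
    using I JI by (auto simp: column_matroid_def)
next
  fix I J assume I: "I \<in> column_matroid K R E A" and J: "J \<in> column_matroid K R E A"
    and card: "card I < card J"
  have fin: "finite I" "finite J" and sub: "I \<subseteq> E" "J \<subseteq> E"
    using I J assms by (auto simp: column_matroid_def intro: finite_subset)
  show "\<exists>x\<in>J - I. insert x I \<in> column_matroid K R E A"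
  proof (rule ccontr)
    assume neg: "\<not> (\<exists>x\<in>J - I. insert x I \<in> column_matroid K R E A)"
    have "card J \<le> card I"
    proof (rule card_le_of_spanned[OF J fin])
      fix x assume x: "x \<in> J"
      show "\<exists>d. (\<forall>e\<in>I. d e \<in> K) \<and> (\<forall>r\<in>R. A r x = (\<Sum>e\<in>I. d e * A r e))"
      proof (cases "x \<in> I")
        case True
        then show ?thesis using fin
          by (intro exI[of _ "\<lambda>e. if e = x then 1 else 0"])
             (auto simp: subfield_set_zero subfield_set_one if_distrib[of "\<lambda>u. u * _"] cong: if_cong)
      next
        case False
        then show ?thesis using spanned_if_not_independent[OF I fin(1)] x neg sub by blast
      qed
    qed
    with card show False by simp
  qed
qed (use assms in \<open>auto simp: column_matroid_def\<close>)

end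

section \<open>Relations as functions on the whole ground set\<close>

definition linear_relation :: "'r set \<Rightarrow> 'e set \<Rightarrow> ('r \<Rightarrow> 'e \<Rightarrow> 'f::field) \<Rightarrow> ('e \<Rightarrow> 'f) \<Rightarrow> bool" where
  "linear_relation R E A c \<longleftrightarrow> (\<forall>r\<in>R. (\<Sum>e\<in>E. c e * A r e) = 0)"

lemma linear_relation_diff:
  "linear_relation R E A c \<Longrightarrow> linear_relation R E A d \<Longrightarrow> linear_relation R E A (\<lambda>e. c e - d e)"
  by (simp add: linear_relation_def algebra_simps sum_subtractf)

lemma linear_relation_cmult:
  "linear_relation R E A c \<Longrightarrow> linear_relation R E A (\<lambda>e. k * c e)"
  by (simp add: linear_relation_def mult.assoc flip: sum_distrib_left)

lemma linear_relation_sum: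
  assumes "\<And>i. i \<in> S \<Longrightarrow> linear_relation R E A (c i)"
  shows "linear_relation R E A (\<lambda>e. \<Sum>i\<in>S. c i e)"
  unfolding linear_relation_def
proof
  fix r assume "r \<in> R"
  have "(\<Sum>e\<in>E. (\<Sum>i\<in>S. c i e) * A r e) = (\<Sum>i\<in>S. \<Sum>e\<in>E. c i e * A r e)"
    by (subst sum.swap) (simp add: sum_distrib_right)
  also have "\<dots> = 0" using assms \<open>r \<in> R\<close> by (simp add: linear_relation_def)
  finally show "(\<Sum>e\<in>E. (\<Sum>i\<in>S. c i e) * A r e) = 0" .
qed

text \<open>Extension by zero makes a dependency of \<open>I\<close> a relation on all of
  \<open>E\<close> vanishing off \<open>I\<close>; here \<open>K\<close> must contain 0. In this
  form relations with different supports can be added and scaled.\<close>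

lemma in_column_matroid_iff:
  assumes "finite E" and "0 \<in> K"
  shows "I \<in> column_matroid K R E A \<longleftrightarrow> I \<subseteq> E \<and>
    (\<forall>c. range c \<subseteq> K \<and> (\<forall>e. e \<notin> I \<longrightarrow> c e = 0) \<and> linear_relation R E A c \<longrightarrow> (\<forall>e. c e = 0))"
    (is "_ \<longleftrightarrow> _ \<and> ?P")
proof (cases "I \<subseteq> E")
  case True
  have sum_eq: "(\<Sum>e\<in>E. c e * A r e) = (\<Sum>e\<in>I. c' e * A r e)"
    if "\<And>e. e \<notin> I \<Longrightarrow> c e = 0" "\<And>e. e \<in> I \<Longrightarrow> c e = c' e" for c c' r
    using assms(1) True that by (intro sum.mono_neutral_cong_right) auto
  show ?thesis
  proof
    assume I: "I \<in> column_matroid K R E A"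
    have "c e = 0" if "range c \<subseteq> K" "\<forall>e. e \<notin> I \<longrightarrow> c e = 0" "linear_relation R E A c" for c e
    proof (cases "e \<in> I")
      case True
      have "\<forall>r\<in>R. (\<Sum>e\<in>I. c e * A r e) = 0"
        using that(2,3) sum_eq[of c c] by (simp add: linear_relation_def)
      then show ?thesis using I that(1) True unfolding column_matroid_def by blast
    qed (use that in simp)
    then show "I \<subseteq> E \<and> ?P" using True by blast
  next
    assume P: "I \<subseteq> E \<and> ?P"
    have "\<forall>e\<in>I. c e = 0"
      if c: "\<forall>e\<in>I. c e \<in> K" and 0: "\<forall>r\<in>R. (\<Sum>e\<in>I. c e * A r e) = 0" for c
    proof -
      define c' where "c' e = (if e \<in> I then c e else 0)" for e
      have "linear_relation R E A c'"
        using sum_eq[of c' c] 0 by (simp add: linear_relation_def c'_def)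
      moreover have "range c' \<subseteq> K" using c assms(2) by (auto simp: c'_def)
      moreover have "\<forall>e. e \<notin> I \<longrightarrow> c' e = 0" by (simp add: c'_def)
      ultimately have "\<forall>e. c' e = 0" using P by blast
      then show ?thesis by (metis c'_def)
    qed
    then show "I \<in> column_matroid K R E A" using True unfolding column_matroid_def by blast
  qed
qed (simp add: column_matroid_def)

lemma linear_relation_cong:
  assumes "\<And>e. e \<in> E \<Longrightarrow> c e = c' e"
  shows "linear_relation R E A c \<longleftrightarrow> linear_relation R E A c'"
  using assms unfolding linear_relation_def by (simp cong: sum.cong)

section \<open>Specialization of linearly independent columns\<close>

text \<open>\<open>T\<close> is the graph of a ring homomorphism from a subring of \<open>'k\<close> to \<open>'f\<close>, along which independence
  can be pulled back by Gaussian elimination without divisions.\<close>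

lemma independent_columns_if_specialized:
  fixes A :: "'r \<Rightarrow> 'e \<Rightarrow> 'k::field" and A' :: "'r \<Rightarrow> 'e \<Rightarrow> 'f::field"
  assumes T0: "\<And>y. T 0 y \<Longrightarrow> y = 0"
    and Tdiff: "\<And>x y x' y'. T x y \<Longrightarrow> T x' y' \<Longrightarrow> T (x - x') (y - y')"
    and Tmult: "\<And>x y x' y'. T x y \<Longrightarrow> T x' y' \<Longrightarrow> T (x * x') (y * y')"
    and "finite I"
    and "\<And>r e. r \<in> R \<Longrightarrow> e \<in> I \<Longrightarrow> T (A r e) (A' r e)"
    and "\<And>c. \<forall>r\<in>R. (\<Sum>e\<in>I. c e * A' r e) = 0 \<Longrightarrow> \<forall>e\<in>I. c e = 0"
    and "\<forall>r\<in>R. (\<Sum>e\<in>I. c e * A r e) = 0"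
  shows "\<forall>e\<in>I. c e = 0"
  using assms(4-)
proof (induction I arbitrary: A A' c rule: finite_induct)
  case empty
  then show ?case by simp
next
  case (insert x I)
  have "\<exists>r\<in>R. A' r x \<noteq> 0"
  proof (rule ccontr)
    assume neg: "\<not> ?thesis"
    have "(\<Sum>e\<in>insert x I. (if e = x then 1 else 0) * A' r e) = 0" if "r \<in> R" for r
      using neg that insert.hyps by (auto intro!: sum.neutral)
    then show False using insert.prems(2)[of "\<lambda>e. if e = x then 1 else 0"] by auto
  qed
  then obtain s where s: "s \<in> R" "A' s x \<noteq> 0" by blast
  \<comment> \<open>A nonzero pivot lifts: by \<open>T0\<close>, zero is related to nothing but
    zero.\<close>
  then have s0: "A s x \<noteq> 0" using insert.prems(1)[of s x] T0 by force
  \<comment> \<open>Cross-multiplied elimination of column \<open>x\<close> with pivot row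
    \<open>s\<close>. Since only products and differences occur, \<open>T\<close> still relates the
    entries.\<close>
  define B where "B r e = A s x * A r e - A s e * A r x" for r e
  define B' where "B' r e = A' s x * A' r e - A' s e * A' r x" for r e
  have eq: "c x * A r x + (\<Sum>e\<in>I. c e * A r e) = 0" if "r \<in> R" for r
    using insert.prems(3) insert.hyps that by simp
  have "\<forall>e\<in>I. c e = 0"
  proof (rule insert.IH)
    show "T (B r e) (B' r e)" if "r \<in> R" "e \<in> I" for r e
      unfolding B_def B'_def using that s insert.prems(1) by (intro Tdiff Tmult) auto
    show "\<forall>e\<in>I. d e = 0" if d: "\<forall>r\<in>R. (\<Sum>e\<in>I. d e * B' r e) = 0" for d
    proof -
      \<comment> \<open>Lifts a relation of \<open>B'\<close> to one of \<open>A'\<close>; the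
        coefficient at \<open>x\<close> collects the subtracted multiples of column
        \<open>x\<close>. Thus the columns of \<open>B'\<close> inherit independence.\<close>
      define d' where "d' e = (if e = x then - (\<Sum>f\<in>I. d f * A' s f) else A' s x * d e)" for e
      have "(\<Sum>e\<in>insert x I. d' e * A' r e) = (\<Sum>e\<in>I. d e * B' r e)" for r
      proof -
        have "(\<Sum>e\<in>I. d' e * A' r e) = (\<Sum>e\<in>I. A' s x * d e * A' r e)"
          using insert.hyps by (intro sum.cong) (auto simp: d'_def)
        then show ?thesis using insert.hyps
          by (simp add: d'_def B'_def algebra_simps sum_subtractf sum_distrib_left)
      qed
      then have "\<forall>e\<in>insert x I. d' e = 0" using insert.prems(2)[of d'] d by simp
      then show ?thesis by (metis d'_def insert.hyps(2) insertCI mult_eq_0_iff s(2))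
    qed
    show "\<forall>r\<in>R. (\<Sum>e\<in>I. c e * B r e) = 0"
    proof
      fix r assume r: "r \<in> R"
      have "(\<Sum>e\<in>I. c e * B r e)
          = A s x * (\<Sum>e\<in>I. c e * A r e) - (\<Sum>e\<in>I. c e * A s e) * A r x"
        by (simp add: B_def algebra_simps sum_subtractf sum_distrib_left)
      also have "(\<Sum>e\<in>I. c e * A r e) = - (c x * A r x)"
        using eq[OF r] by (simp add: eq_neg_iff_add_eq_0 add.commute)
      also have "(\<Sum>e\<in>I. c e * A s e) = - (c x * A s x)"
        using eq[OF s(1)] by (simp add: eq_neg_iff_add_eq_0 add.commute)
      finally show "(\<Sum>e\<in>I. c e * B r e) = 0" by simp
    qed
  qed
  moreover from this have "c x = 0" using eq[OF s(1)] s0 by simp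
  ultimately show ?case by simp
qed

text \<open>Integer coefficients can be evaluated in every characteristic. The values
  \<open>g\<close> of the monomials are left open so that one definition serves both the embedding
  into \<open>ratfun\<close> and the substitution into the target field.\<close>

definition int_poly_eval :: "('m \<Rightarrow> 'a::comm_ring_1) \<Rightarrow> ('m \<Rightarrow>\<^sub>0 int) \<Rightarrow> 'a" where
  "int_poly_eval g p = (\<Sum>\<mu>\<in>Poly_Mapping.keys p. of_int (Poly_Mapping.lookup p \<mu>) * g \<mu>)"

lemma int_poly_eval_superset:
  assumes "finite S" and "Poly_Mapping.keys p \<subseteq> S"
  shows "int_poly_eval g p = (\<Sum>\<mu>\<in>S. of_int (Poly_Mapping.lookup p \<mu>) * g \<mu>)"
  unfolding int_poly_eval_def using assms
  by (intro sum.mono_neutral_left) (auto simp: in_keys_iff)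

lemma int_poly_eval_zero: "int_poly_eval g 0 = 0"
  by (simp add: int_poly_eval_def)

lemma int_poly_eval_frag_of: "int_poly_eval g (frag_of \<mu>) = g \<mu>"
  by (simp add: int_poly_eval_def)

lemma int_poly_eval_diff: "int_poly_eval g (p - q) = int_poly_eval g p - int_poly_eval g q"
proof -
  let ?S = "Poly_Mapping.keys p \<union> Poly_Mapping.keys q"
  have "Poly_Mapping.keys (p - q) \<subseteq> ?S" by (rule keys_diff)
  then show ?thesis
    by (simp add: int_poly_eval_superset[of ?S] Poly_Mapping.lookup_minus algebra_simps sum_subtractf)
qed

text \<open>Both sides are additive in each factor, so induction over the free abelian group reduces
  the claim to monomials.\<close>

lemma int_poly_eval_mult:
  fixes g :: "'m::comm_monoid_add \<Rightarrow> 'a::comm_ring_1"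
  assumes g: "\<And>\<mu> \<nu>. g (\<mu> + \<nu>) = g \<mu> * g \<nu>"
  shows "int_poly_eval g (p * q) = int_poly_eval g p * int_poly_eval g q"
proof (induction p rule: frag_induction[OF subset_UNIV, case_names zero one diff])
  case (one \<mu>)
  show ?case
    by (induction q rule: frag_induction[OF subset_UNIV, case_names zero one diff])
       (simp_all add: int_poly_eval_zero int_poly_eval_frag_of int_poly_eval_diff
          right_diff_distrib Poly_Mapping.mult_single g)
qed (simp_all add: int_poly_eval_zero int_poly_eval_diff left_diff_distrib)

definition monomial_eval :: "(nat \<Rightarrow> 'f::field) \<Rightarrow> (nat \<Rightarrow>\<^sub>0 nat) \<Rightarrow> 'f" where
  "monomial_eval z \<mu> = (\<Prod>k\<in>Poly_Mapping.keys \<mu>. z k ^ Poly_Mapping.lookup \<mu> k)"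

lemma monomial_eval_superset:
  assumes "finite S" and "Poly_Mapping.keys \<mu> \<subseteq> S"
  shows "monomial_eval z \<mu> = (\<Prod>k\<in>S. z k ^ Poly_Mapping.lookup \<mu> k)"
  unfolding monomial_eval_def using assms
  by (intro prod.mono_neutral_left) (auto simp: in_keys_iff)

lemma monomial_eval_add: "monomial_eval z (\<mu> + \<nu>) = monomial_eval z \<mu> * monomial_eval z \<nu>"
proof -
  let ?S = "Poly_Mapping.keys \<mu> \<union> Poly_Mapping.keys \<nu>"
  have "Poly_Mapping.keys (\<mu> + \<nu>) \<subseteq> ?S" by (rule Poly_Mapping.keys_add)
  then show ?thesis
    by (simp add: monomial_eval_superset[of ?S] Poly_Mapping.lookup_add power_add prod.distrib)
qed

definition ratfun_monomial :: "(nat \<Rightarrow>\<^sub>0 nat) \<Rightarrow> ratfun" where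
  "ratfun_monomial \<mu> = Fract (Poly_Mapping.single \<mu> 1) 1"

lemma ratfun_monomial_add: "ratfun_monomial (\<mu> + \<nu>) = ratfun_monomial \<mu> * ratfun_monomial \<nu>"
  by (simp add: ratfun_monomial_def Poly_Mapping.mult_single)

lemma of_int_mult_ratfun_monomial:
  "of_int k * ratfun_monomial \<mu> = Fract (Poly_Mapping.single \<mu> (of_int k)) 1"
proof -
  have nat: "of_nat k * ratfun_monomial \<mu> = Fract (Poly_Mapping.single \<mu> (of_nat k)) 1" for k
    by (induction k)
       (simp_all add: ratfun_monomial_def distrib_right Zero_fract_def Poly_Mapping.single_add)
  show ?thesis
    by (cases k rule: int_cases2) (simp_all add: nat Poly_Mapping.single_uminus)
qed

text \<open>The fractions have denominator 1 and distinct monomials do not interact, so each integer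
  coefficient can be read off in the rationals. This injectivity is the algebraic independence of
  the indeterminates.\<close>

lemma int_poly_eval_ratfun_monomial_eq_0:
  assumes "int_poly_eval ratfun_monomial p = 0"
  shows "p = 0"
proof -
  define f :: "(nat \<Rightarrow>\<^sub>0 nat) \<Rightarrow> ((nat \<Rightarrow>\<^sub>0 nat) \<Rightarrow>\<^sub>0 rat)"
    where "f \<mu> = Poly_Mapping.single \<mu> (of_int (Poly_Mapping.lookup p \<mu>))" for \<mu>
  have sum_Fract: "(\<Sum>\<mu>\<in>S. Fract (f \<mu>) 1) = Fract (sum f S) 1" for S
    by (induction S rule: infinite_finite_induct) (simp_all add: Zero_fract_def)
  have "Fract (\<Sum>\<mu>\<in>Poly_Mapping.keys p. f \<mu>) 1 = 0"
    using assms by (simp add: int_poly_eval_def of_int_mult_ratfun_monomial flip: f_def sum_Fract)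
  then have 0: "(\<Sum>\<mu>\<in>Poly_Mapping.keys p. f \<mu>) = 0"
    by (simp add: Zero_fract_def eq_fract)
  have "Poly_Mapping.lookup p \<nu> = 0" for \<nu>
  proof (rule ccontr)
    assume nz: "Poly_Mapping.lookup p \<nu> \<noteq> 0"
    have "Poly_Mapping.lookup (\<Sum>\<mu>\<in>Poly_Mapping.keys p. f \<mu>) \<nu>
        = (\<Sum>\<mu>\<in>Poly_Mapping.keys p. if \<mu> = \<nu> then of_int (Poly_Mapping.lookup p \<mu>) else 0)"
      by (simp add: Poly_Mapping.lookup_sum f_def Poly_Mapping.lookup_single when_def cong: if_cong)
    also have "\<dots> = of_int (Poly_Mapping.lookup p \<nu>)"
      using nz by (simp add: in_keys_iff)
    finally show False using 0 nz by simp
  qed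
  then show ?thesis by (simp add: poly_mapping_eq_iff fun_eq_iff)
qed

text \<open>Substituting the entries of \<open>u\<close> and \<open>v\<close> for the indeterminates
  is a ring homomorphism on integer polynomials, so independence lifts along it. The field
  \<open>'f\<close> may have any characteristic.\<close>

lemma generic_birigidity_matroid_if_specialized:
  fixes u v :: "nat \<Rightarrow> nat \<Rightarrow> 'f::field"
  assumes I: "I \<in> birigidity_column_matroid UNIV a b m n u v"
  shows "I \<in> generic_birigidity_matroid a b m n"
proof -
  \<comment> \<open>Undoes the codings in \<open>X_indet\<close> and \<open>Y_indet\<close>, so that
    the indeterminate number \<open>k\<close> is sent to the right entry of \<open>u\<close> or
    \<open>v\<close>.\<close>
  define z where "z k = (case sum_decode k of
      Inl l \<Rightarrow> case_prod u (prod_decode l) | Inr l \<Rightarrow> case_prod v (prod_decode l))" for k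
  \<comment> \<open>The graph of the substitution; \<open>T0\<close> is where injectivity of the
    embedding into \<open>ratfun\<close> enters.\<close>
  define T where "T x y \<longleftrightarrow> (\<exists>p. x = int_poly_eval ratfun_monomial p \<and>
      y = int_poly_eval (monomial_eval z) p)" for x y
  have T0: "y = 0" if "T 0 y" for y
    using that unfolding T_def
    by (auto dest: int_poly_eval_ratfun_monomial_eq_0 simp: int_poly_eval_zero)
  have Tdiff: "T (x - x') (y - y')" if "T x y" "T x' y'" for x y x' y'
    using that unfolding T_def by (auto simp flip: int_poly_eval_diff)
  have Tmult: "T (x * x') (y * y')" if "T x y" "T x' y'" for x y x' y'
    using that unfolding T_def
    by (auto simp: monomial_eval_add ratfun_monomial_add simp flip: int_poly_eval_mult)
  have T00: "T 0 0" unfolding T_def by (metis int_poly_eval_zero)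
  have Tz: "T (indet k) (z k)" for k
    unfolding T_def
    by (rule exI[of _ "frag_of (Poly_Mapping.single k 1)"])
       (simp add: int_poly_eval_frag_of ratfun_monomial_def indet_def monomial_eval_def)
  have TX: "T (X_indet i r) (u i r)" for i r
    using Tz[of "sum_encode (Inl (prod_encode (i, r)))"] by (simp add: X_indet_def z_def)
  have TY: "T (Y_indet j s) (v j s)" for j s
    using Tz[of "sum_encode (Inr (prod_encode (j, s)))"] by (simp add: Y_indet_def z_def)
  have T: "T (birigidity_matrix X_indet Y_indet r e) (birigidity_matrix u v r e)" for r e
    by (cases r; cases e) (simp_all add: TX TY T00)
  have sub: "I \<subseteq> bigraph_edges m n" using I
    by (simp add: birigidity_column_matroid_def column_matroid_def)
  then have fin: "finite I" by (rule finite_subset) auto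
  have indep: "\<forall>e\<in>I. c e = 0"
    if "\<forall>r\<in>birigidity_rows a b m n. (\<Sum>e\<in>I. c e * birigidity_matrix u v r e) = 0" for c
    using I that unfolding birigidity_column_matroid_def column_matroid_def by blast
  \<comment> \<open>Here \<open>c\<close> ranges over all of \<open>ratfun\<close>; independence
    over \<open>generic_field\<close> follows by restricting the coefficients.\<close>
  have "\<forall>e\<in>I. c e = 0"
    if "\<forall>r\<in>birigidity_rows a b m n. (\<Sum>e\<in>I. c e * birigidity_matrix X_indet Y_indet r e) = 0" for c
    by (rule independent_columns_if_specialized[where T = T, OF T0 Tdiff Tmult fin T indep that])
  then show ?thesis using sub
    unfolding generic_birigidity_matroid_def birigidity_column_matroid_def column_matroid_def
    by blast
qed

section \<open>Birigidity matrices\<close>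

text \<open>Reading \<open>c\<close> as a matrix, the label \<open>URow i q\<close> sees only its
  row \<open>i\<close> and \<open>VRow p j\<close> only its column \<open>j\<close>. Hence relations
  are matrices whose rows are relations of the vectors \<open>v\<close> and whose columns are
  relations of the vectors \<open>u\<close>.\<close>

lemma linear_relation_birigidity_iff:
  "linear_relation (birigidity_rows a b m n) (bigraph_edges m n) (birigidity_matrix u v) c \<longleftrightarrow>
     (\<forall>i\<in>{1..m}. \<forall>q\<in>{1..b}. (\<Sum>j\<in>{1..n}. c (i, j) * v j q) = 0) \<and>
     (\<forall>j\<in>{1..n}. \<forall>p\<in>{1..a}. (\<Sum>i\<in>{1..m}. c (i, j) * u i p) = 0)"
proof -
  have edges: "(\<Sum>e\<in>bigraph_edges m n. g e) = (\<Sum>i\<in>{1..m}. \<Sum>j\<in>{1..n}. g (i, j))" for g :: "_ \<Rightarrow> 'a"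
    by (simp add: sum.cartesian_product)
  have U: "(\<Sum>e\<in>bigraph_edges m n. c e * birigidity_matrix u v (URow i q) e)
      = (\<Sum>j\<in>{1..n}. c (i, j) * v j q)" if "i \<in> {1..m}" for i q
    unfolding edges using that by (subst sum.swap) (simp add: if_distrib cong: if_cong)
  have V: "(\<Sum>e\<in>bigraph_edges m n. c e * birigidity_matrix u v (VRow p j) e)
      = (\<Sum>i\<in>{1..m}. c (i, j) * u i p)" if "j \<in> {1..n}" for p j
    unfolding edges using that by (simp add: if_distrib cong: if_cong)
  have rows: "(\<forall>r\<in>birigidity_rows a b m n. P r) \<longleftrightarrow>
      (\<forall>i\<in>{1..m}. \<forall>q\<in>{1..b}. P (URow i q)) \<and> (\<forall>j\<in>{1..n}. \<forall>p\<in>{1..a}. P (VRow p j))" for P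
    unfolding birigidity_rows_def by blast
  show ?thesis
    unfolding linear_relation_def rows by (simp only: U V cong: ball_cong)
qed

lemma in_birigidity_column_matroid_iff:
  assumes "0 \<in> K"
  shows "I \<in> birigidity_column_matroid K a b m n u v \<longleftrightarrow> I \<subseteq> bigraph_edges m n \<and>
    (\<forall>c. range c \<subseteq> K \<and> (\<forall>e. e \<notin> I \<longrightarrow> c e = 0) \<and>
       (\<forall>i\<in>{1..m}. \<forall>q\<in>{1..b}. (\<Sum>j\<in>{1..n}. c (i, j) * v j q) = 0) \<and>
       (\<forall>j\<in>{1..n}. \<forall>p\<in>{1..a}. (\<Sum>i\<in>{1..m}. c (i, j) * u i p) = 0) \<longrightarrow> (\<forall>e. c e = 0))"
  unfolding birigidity_column_matroid_def linear_relation_birigidity_iff[symmetric]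
  by (rule in_column_matroid_iff) (simp_all add: assms)

text \<open>The complement of \<open>{a<..m} \<times> {b<..n}\<close> is a basis of every abstract birigidity matroid.\<close>

definition hook_edges :: "nat \<Rightarrow> nat \<Rightarrow> nat \<Rightarrow> nat \<Rightarrow> (nat \<times> nat) set" where
  "hook_edges a b m n = bigraph_edges m n - {a<..m} \<times> {b<..n}"

section \<open>The axioms of an abstract birigidity matroid for the generic matroid\<close>

lemma card_hook_edges:
  assumes "a \<le> m" and "b \<le> n"
  shows "int (card (hook_edges a b m n)) = int m * int n - (int m - int a) * (int n - int b)"
proof -
  have "{a<..m} \<times> {b<..n} \<subseteq> bigraph_edges m n" by auto
  then have "card (bigraph_edges m n) = card (hook_edges a b m n) + card ({a<..m} \<times> {b<..n})"
    unfolding hook_edges_def by (metis card_Diff_subset card_mono finite_SigmaI finite_atLeastAtMost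
        finite_greaterThanAtMost le_add_diff_inverse2)
  then have "int m * int n = int (card (hook_edges a b m n)) + int (m - a) * int (n - b)"
    by (simp add: card_cartesian_product flip: of_nat_mult)
  then show ?thesis using assms by (simp add: of_nat_diff)
qed

text \<open>Specialize to unit vectors for the first \<open>a\<close> and \<open>b\<close> indices
  and to zero vectors beyond. Each equation of the kernel then isolates one entry of
  \<open>c\<close>, and together they kill every entry on the hook.\<close>

lemma hook_edges_generic: "hook_edges a b m n \<in> generic_birigidity_matroid a b m n"
proof -
  define e :: "nat \<Rightarrow> nat \<Rightarrow> rat" where "e i p = (if i = p then 1 else 0)" for i p
  have "hook_edges a b m n \<in> birigidity_column_matroid UNIV a b m n e e"
  proof (subst in_birigidity_column_matroid_iff, simp, intro conjI allI impI)
    show "hook_edges a b m n \<subseteq> bigraph_edges m n" by (auto simp: hook_edges_def)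
    fix c :: "nat \<times> nat \<Rightarrow> rat" and x
    assume "range c \<subseteq> UNIV \<and> (\<forall>x. x \<notin> hook_edges a b m n \<longrightarrow> c x = 0) \<and>
      (\<forall>i\<in>{1..m}. \<forall>q\<in>{1..b}. (\<Sum>j\<in>{1..n}. c (i, j) * e j q) = 0) \<and>
      (\<forall>j\<in>{1..n}. \<forall>p\<in>{1..a}. (\<Sum>i\<in>{1..m}. c (i, j) * e i p) = 0)"
    then have c: "\<And>x. x \<notin> hook_edges a b m n \<Longrightarrow> c x = 0"
      "\<And>i q. i \<in> {1..m} \<Longrightarrow> q \<in> {1..b} \<Longrightarrow> (\<Sum>j\<in>{1..n}. c (i, j) * e j q) = 0"
      "\<And>j p. j \<in> {1..n} \<Longrightarrow> p \<in> {1..a} \<Longrightarrow> (\<Sum>i\<in>{1..m}. c (i, j) * e i p) = 0"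
      by blast+
    show "c x = 0"
    proof (cases "x \<in> hook_edges a b m n")
      case True
      obtain i j where x: "x = (i, j)" by (cases x)
      consider "i \<in> {1..m}" "j \<in> {1..n}" "i \<in> {1..a}" | "i \<in> {1..m}" "j \<in> {1..n}" "j \<in> {1..b}"
        using True x by (force simp: hook_edges_def)
      then show ?thesis
      proof cases
        case 1
        with c(3)[of j i] show ?thesis by (simp add: x e_def if_distrib cong: if_cong)
      next
        case 2
        with c(2)[of i j] show ?thesis by (simp add: x e_def if_distrib cong: if_cong)
      qed
    qed (use c(1) in simp)
  qed
  then show ?thesis by (rule generic_birigidity_matroid_if_specialized)
qed

text \<open>The \<open>a + 1\<close> vectors indexed by \<open>A\<close> have a relation \<alpha>,
  the \<open>b + 1\<close> vectors indexed by \<open>D\<close> a relation \<beta>; their product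
  \<alpha> \<otimes> \<beta> is a nonzero relation supported in \<open>A \<times> D\<close>.\<close>

lemma biclique_dependent:
  assumes K: "subfield_set K" and AD: "A \<subseteq> {1..m}" "D \<subseteq> {1..n}" "card A = a + 1" "card D = b + 1"
    and u: "\<And>i p. i \<in> {1..m} \<Longrightarrow> p \<in> {1..a} \<Longrightarrow> u i p \<in> K"
    and v: "\<And>j q. j \<in> {1..n} \<Longrightarrow> q \<in> {1..b} \<Longrightarrow> v j q \<in> K"
  shows "A \<times> D \<notin> birigidity_column_matroid K a b m n u v"
proof
  assume indep: "A \<times> D \<in> birigidity_column_matroid K a b m n u v"
  note closed = subfield_set_closed[OF K]
  have fin: "finite A" "finite D" using AD by (auto intro: finite_subset)
  have "\<exists>\<alpha>. (\<forall>i\<in>A. \<alpha> i \<in> K) \<and> (\<exists>i\<in>A. \<alpha> i \<noteq> 0) \<and> (\<forall>p\<in>{1..a}. (\<Sum>i\<in>A. \<alpha> i * u i p) = 0)"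
    by (rule homogeneous_system_nontrivial_solution[OF K, where D = "\<lambda>p i. u i p"])
       (use AD fin u in auto)
  then obtain \<alpha> where \<alpha>: "\<forall>i\<in>A. \<alpha> i \<in> K" "\<exists>i\<in>A. \<alpha> i \<noteq> 0" "\<forall>p\<in>{1..a}. (\<Sum>i\<in>A. \<alpha> i * u i p) = 0"
    by blast
  have "\<exists>\<beta>. (\<forall>j\<in>D. \<beta> j \<in> K) \<and> (\<exists>j\<in>D. \<beta> j \<noteq> 0) \<and> (\<forall>q\<in>{1..b}. (\<Sum>j\<in>D. \<beta> j * v j q) = 0)"
    by (rule homogeneous_system_nontrivial_solution[OF K, where D = "\<lambda>q j. v j q"])
       (use AD fin v in auto)
  then obtain \<beta> where \<beta>: "\<forall>j\<in>D. \<beta> j \<in> K" "\<exists>j\<in>D. \<beta> j \<noteq> 0" "\<forall>q\<in>{1..b}. (\<Sum>j\<in>D. \<beta> j * v j q) = 0"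
    by blast
  define \<alpha>' where "\<alpha>' i = (if i \<in> A then \<alpha> i else 0)" for i
  define \<beta>' where "\<beta>' j = (if j \<in> D then \<beta> j else 0)" for j
  define c where "c = (\<lambda>(i, j). \<alpha>' i * \<beta>' j)"
  have \<alpha>0: "(\<Sum>i\<in>{1..m}. \<alpha>' i * u i p) = 0" if "p \<in> {1..a}" for p
  proof -
    have "(\<Sum>i\<in>{1..m}. \<alpha>' i * u i p) = (\<Sum>i\<in>A. \<alpha> i * u i p)"
      using AD(1) by (intro sum.mono_neutral_cong_right) (auto simp: \<alpha>'_def)
    then show ?thesis using \<alpha>(3) that by simp
  qed
  have \<beta>0: "(\<Sum>j\<in>{1..n}. \<beta>' j * v j q) = 0" if "q \<in> {1..b}" for q
  proof -
    have "(\<Sum>j\<in>{1..n}. \<beta>' j * v j q) = (\<Sum>j\<in>D. \<beta> j * v j q)"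
      using AD(2) by (intro sum.mono_neutral_cong_right) (auto simp: \<beta>'_def)
    then show ?thesis using \<beta>(3) that by simp
  qed
  have "\<alpha>' i \<in> K" "\<beta>' i \<in> K" for i
    using \<alpha>(1) \<beta>(1) closed by (auto simp: \<alpha>'_def \<beta>'_def)
  then have "range c \<subseteq> K" by (auto simp: c_def closed)
  moreover have "\<forall>e. e \<notin> A \<times> D \<longrightarrow> c e = 0" by (auto simp: c_def \<alpha>'_def \<beta>'_def)
  moreover have "\<forall>i\<in>{1..m}. \<forall>q\<in>{1..b}. (\<Sum>j\<in>{1..n}. c (i, j) * v j q) = 0"
    using \<beta>0 by (simp add: c_def mult.assoc flip: sum_distrib_left)
  moreover have "\<forall>j\<in>{1..n}. \<forall>p\<in>{1..a}. (\<Sum>i\<in>{1..m}. c (i, j) * u i p) = 0"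
  proof (intro ballI)
    fix j p assume "p \<in> {1..a}"
    have "(\<Sum>i\<in>{1..m}. c (i, j) * u i p) = \<beta>' j * (\<Sum>i\<in>{1..m}. \<alpha>' i * u i p)"
      by (simp add: c_def sum_distrib_left mult_ac)
    then show "(\<Sum>i\<in>{1..m}. c (i, j) * u i p) = 0" using \<alpha>0 \<open>p \<in> {1..a}\<close> by simp
  qed
  ultimately have "\<forall>e. c e = 0"
    using indep closed(1) unfolding in_birigidity_column_matroid_iff[OF closed(1)] by blast
  moreover from \<alpha>(2) \<beta>(2) obtain i j where "i \<in> A" "\<alpha> i \<noteq> 0" "j \<in> D" "\<beta> j \<noteq> 0" by blast
  then have "c (i, j) \<noteq> 0" by (simp add: c_def \<alpha>'_def \<beta>'_def)
  ultimately show False by blast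
qed

text \<open>A linear relation supported in \<open>A \<times> D\<close> is constant there when the vectors indexed by \<open>A - {i\<^sub>0}\<close> are the unit
  vectors and \<open>i\<^sub>0\<close> gets minus their sum.\<close>

lemma generic_proper_subset_of_biclique:
  assumes AD: "A \<subseteq> {1..m}" "D \<subseteq> {1..n}" "card A = a + 1" "card D = b + 1" and S: "S \<subset> A \<times> D"
  shows "S \<in> generic_birigidity_matroid a b m n"
proof -
  have simplex: "\<exists>w :: nat \<Rightarrow> nat \<Rightarrow> rat. \<forall>f. (\<forall>i. i \<notin> B \<longrightarrow> f i = 0) \<and>
      (\<forall>p\<in>{1..d}. (\<Sum>i\<in>{1..k}. f i * w i p) = 0) \<longrightarrow> (\<forall>i\<in>B. f i = f x)"
    if B: "B \<subseteq> {1..k}" "card B = d + 1" "x \<in> B" for B :: "nat set" and k d x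
  proof -
    have fin: "finite B" using B(1) by (auto intro: finite_subset)
    then have "card (B - {x}) = card {1..d}" using B by simp
    then obtain h where h: "bij_betw h (B - {x}) {1..d}"
      using fin by (metis finite_same_card_bij finite_Diff finite_atLeastAtMost)
    \<comment> \<open>Since \<open>h\<close> numbers \<open>B - {x}\<close>, for \<open>y\<close>
      other than \<open>x\<close> the coordinate \<open>h y\<close> involves only \<open>x\<close>
      and \<open>y\<close>, and its equation reads \<open>f y - f x = 0\<close>.\<close>
    define w :: "nat \<Rightarrow> nat \<Rightarrow> rat"
      where "w i p = (if i = x then - 1 else if h i = p then 1 else 0)" for i p
    have "f y = f x" if supp: "\<forall>i. i \<notin> B \<longrightarrow> f i = 0"
      and f: "\<forall>p\<in>{1..d}. (\<Sum>i\<in>{1..k}. f i * w i p) = 0" and y: "y \<in> B" for f y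
    proof (cases "y = x")
      case False
      then have y': "y \<in> B - {x}" using y by simp
      have "h y \<in> {1..d}" using h y' by (auto simp: bij_betw_def)
      then have "0 = (\<Sum>i\<in>{1..k}. f i * w i (h y))" using f by simp
      also have "\<dots> = (\<Sum>i\<in>{x, y}. f i * w i (h y))"
      proof (rule sum.mono_neutral_right)
        show "\<forall>i\<in>{1..k} - {x, y}. f i * w i (h y) = 0"
        proof
          fix i assume "i \<in> {1..k} - {x, y}"
          then show "f i * w i (h y) = 0"
            using supp h y' by (cases "i \<in> B") (auto simp: w_def bij_betw_def inj_on_def)
        qed
      qed (use B y in auto)
      also have "\<dots> = f y - f x" using False by (simp add: w_def)
      finally show ?thesis by simp
    qed simp
    then show ?thesis by blast
  qed
  \<comment> \<open>An edge missing from \<open>S\<close>, where every relation supported in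
    \<open>S\<close> vanishes.\<close>
  from S obtain i0 j0 where ij: "i0 \<in> A" "j0 \<in> D" "(i0, j0) \<notin> S" by blast
  obtain u :: "nat \<Rightarrow> nat \<Rightarrow> rat" where u: "\<And>f i. (\<forall>i. i \<notin> A \<longrightarrow> f i = 0) \<Longrightarrow>
      (\<forall>p\<in>{1..a}. (\<Sum>i\<in>{1..m}. f i * u i p) = 0) \<Longrightarrow> i \<in> A \<Longrightarrow> f i = f i0"
    using simplex[OF AD(1,3) ij(1)] by blast
  obtain v :: "nat \<Rightarrow> nat \<Rightarrow> rat" where v: "\<And>f j. (\<forall>j. j \<notin> D \<longrightarrow> f j = 0) \<Longrightarrow>
      (\<forall>q\<in>{1..b}. (\<Sum>j\<in>{1..n}. f j * v j q) = 0) \<Longrightarrow> j \<in> D \<Longrightarrow> f j = f j0"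
    using simplex[OF AD(2,4) ij(2)] by blast
  have "S \<in> birigidity_column_matroid UNIV a b m n u v"
  proof (subst in_birigidity_column_matroid_iff, simp, intro conjI allI impI)
    show "S \<subseteq> bigraph_edges m n" using S AD by blast
    fix c :: "nat \<times> nat \<Rightarrow> rat" and x
    assume c: "range c \<subseteq> UNIV \<and> (\<forall>x. x \<notin> S \<longrightarrow> c x = 0) \<and>
      (\<forall>i\<in>{1..m}. \<forall>q\<in>{1..b}. (\<Sum>j\<in>{1..n}. c (i, j) * v j q) = 0) \<and>
      (\<forall>j\<in>{1..n}. \<forall>p\<in>{1..a}. (\<Sum>i\<in>{1..m}. c (i, j) * u i p) = 0)"
    have supp: "c (i, j) = 0" if "i \<notin> A \<or> j \<notin> D" for i j
      using c that S by blast
    show "c x = 0"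
    proof (cases "x \<in> A \<times> D")
      case True
      then obtain i j where x: "x = (i, j)" "i \<in> A" "j \<in> D" by blast
      have "j \<in> {1..n}" "i0 \<in> {1..m}" using x ij AD by auto
      \<comment> \<open>Move along column \<open>j\<close> to row \<open>i0\<close>, then along that
        row to the missing edge.\<close>
      then have "c (i, j) = c (i0, j)" and "c (i0, j) = c (i0, j0)"
        using u[of "\<lambda>i. c (i, j)" i] v[of "\<lambda>j. c (i0, j)" j] supp c x by auto
      then show ?thesis using c ij x by simp
    qed (use c S in blast)
  qed
  then show ?thesis by (rule generic_birigidity_matroid_if_specialized)
qed

lemma matroid_rank_eq_card:
  assumes M: "matroid E M" and B: "B \<in> M" and max: "\<And>x. x \<in> E - B \<Longrightarrow> insert x B \<notin> M"
  shows "matroid_rank M = card B"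
proof -
  have "M \<subseteq> Pow E" "finite E" using M by (auto simp: matroid_def)
  then have "finite M" by (meson finite_Pow_iff finite_subset)
  moreover have "card I \<le> card B" if I: "I \<in> M" for I
  proof (rule ccontr)
    assume "\<not> card I \<le> card B"
    then have "card B < card I" by simp
    moreover have "\<forall>J\<in>M. card B < card J \<longrightarrow> (\<exists>x\<in>J - B. insert x B \<in> M)"
      using M B by (simp add: matroid_def)
    ultimately obtain x where x: "x \<in> I - B" "insert x B \<in> M"
      using I by blast
    then have "x \<in> E" using \<open>M \<subseteq> Pow E\<close> I by auto
    with x max[of x] show False by simp
  qed
  ultimately show ?thesis
    unfolding matroid_rank_def using B by (intro Max_eqI) auto
qed

lemma zero_in_generic_field: "0 \<in> generic_field a b m n"
  unfolding generic_field_def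
  by (rule subfield_set_zero[OF subfield_set_generated_field])

lemma X_indet_in_generic_field:
    "i \<in> {1..m} \<Longrightarrow> p \<in> {1..a} \<Longrightarrow> X_indet i p \<in> generic_field a b m n"
  and Y_indet_in_generic_field:
    "j \<in> {1..n} \<Longrightarrow> q \<in> {1..b} \<Longrightarrow> Y_indet j q \<in> generic_field a b m n"
  unfolding generic_field_def by (blast intro: generated_field.base)+

text \<open>Adding a cell \<open>(i, j)\<close> to the hook completes the biclique on
  \<open>{1..a}\<close> with \<open>i\<close> and \<open>{1..b}\<close> with \<open>j\<close>, which
  is dependent. So the hook is maximal independent and its size is the rank.\<close>

lemma abstract_birigidity_generic:
  assumes "a \<le> m" and "b \<le> n"
  shows "abstract_birigidity a b m n (generic_birigidity_matroid a b m n)"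
proof -
  have K: "subfield_set (generic_field a b m n)"
    unfolding generic_field_def by (rule subfield_set_generated_field)
  have M: "matroid (bigraph_edges m n) (generic_birigidity_matroid a b m n)"
    unfolding generic_birigidity_matroid_def birigidity_column_matroid_def
    by (rule matroid_column_matroid[OF K]) simp
  have dep: "A \<times> D \<notin> generic_birigidity_matroid a b m n"
    if "A \<subseteq> {1..m}" "D \<subseteq> {1..n}" "card A = a + 1" "card D = b + 1" for A D
    unfolding generic_birigidity_matroid_def
    by (rule biclique_dependent[OF K that])
       (simp_all add: X_indet_in_generic_field Y_indet_in_generic_field)
  have "insert x (hook_edges a b m n) \<notin> generic_birigidity_matroid a b m n"
    if x: "x \<in> bigraph_edges m n - hook_edges a b m n" for x
  proof -
    from x obtain i j where ij: "x = (i, j)" "i \<in> {a<..m}" "j \<in> {b<..n}"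
      by (auto simp: hook_edges_def)
    have "insert i {1..a} \<times> insert j {1..b} \<notin> generic_birigidity_matroid a b m n"
      using ij assms by (intro dep) auto
    moreover have "insert i {1..a} \<times> insert j {1..b} \<subseteq> insert x (hook_edges a b m n)"
      using ij assms by (auto simp: hook_edges_def)
    ultimately show ?thesis using M unfolding matroid_def by blast
  qed
  then have "matroid_rank (generic_birigidity_matroid a b m n) = card (hook_edges a b m n)"
    by (rule matroid_rank_eq_card[OF M hook_edges_generic])
  then have "int (matroid_rank (generic_birigidity_matroid a b m n))
      = int m * int n - (int m - int a) * (int n - int b)"
    using card_hook_edges[OF assms] by simp
  moreover have "circuit (bigraph_edges m n) (generic_birigidity_matroid a b m n) (A \<times> D)"
    if "A \<subseteq> {1..m}" "D \<subseteq> {1..n}" "card A = a + 1" "card D = b + 1" for A D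
    unfolding circuit_def using that dep generic_proper_subset_of_biclique[OF that]
    by (simp add: Sigma_mono)
  ultimately show ?thesis using M unfolding abstract_birigidity_def by simp
qed

lemma representable_over_column_matroid:
  assumes "finite R" and "\<And>r e. r \<in> R \<Longrightarrow> e \<in> E \<Longrightarrow> A r e \<in> K"
  shows "representable_over K E (column_matroid K R E A)"
proof -
  obtain h where h: "bij_betw h {..<card R} R"
    using ex_bij_betw_nat_finite[OF assms(1)] by (auto simp: atLeast0LessThan)
  then have R: "R = h ` {..<card R}" by (simp add: bij_betw_def)
  have "column_matroid K R E A = column_matroid K {..<card R} E (\<lambda>r. A (h r))"
    unfolding column_matroid_def by (subst R) simp
  moreover have "\<forall>r<card R. \<forall>e\<in>E. A (h r) e \<in> K"
    using assms(2) R by blast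
  ultimately show ?thesis
    unfolding representable_over_def by (intro exI[of _ "card R"] exI[of _ "\<lambda>r. A (h r)"]) simp
qed

lemma finite_birigidity_rows: "finite (birigidity_rows a b m n)"
proof -
  have "birigidity_rows a b m n
      = case_prod URow ` ({1..m} \<times> {1..b}) \<union> case_prod VRow ` ({1..a} \<times> {1..n})"
    by (auto simp: birigidity_rows_def)
  then show ?thesis by simp
qed

lemma representable_over_generic:
  "representable_over (generic_field a b m n) (bigraph_edges m n) (generic_birigidity_matroid a b m n)"
  unfolding generic_birigidity_matroid_def birigidity_column_matroid_def
  by (rule representable_over_column_matroid[OF finite_birigidity_rows])
     (auto simp: birigidity_rows_def zero_in_generic_field X_indet_in_generic_field
        Y_indet_in_generic_field)

section \<open>Standard representations\<close>

lemma relation_supported_in_independent: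
  assumes "finite E" and "I \<in> column_matroid UNIV R E A"
    and "\<And>e. e \<notin> I \<Longrightarrow> c e = 0" and "linear_relation R E A c"
  shows "c e = 0"
  using assms by (simp add: in_column_matroid_iff)

lemma in_column_matroidI:
  assumes "finite E" and "I \<subseteq> E"
    and "\<And>c e. (\<And>e. e \<notin> I \<Longrightarrow> c e = 0) \<Longrightarrow> linear_relation R E A c \<Longrightarrow> c e = 0"
  shows "I \<in> column_matroid UNIV R E A"
  using assms by (simp add: in_column_matroid_iff)

text \<open>A zero coefficient inside \<open>C\<close> would leave a nontrivial relation supported
  in a proper subset of \<open>C\<close>, which is independent.\<close>

lemma circuit_linear_relation:
  assumes C: "circuit E (column_matroid UNIV R E A) C" and "finite E"
  obtains c where "linear_relation R E A c" and "\<And>e. c e \<noteq> 0 \<longleftrightarrow> e \<in> C"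
proof -
  note iff = in_column_matroid_iff[OF \<open>finite E\<close> UNIV_I, of _ R A]
  have sub: "C \<subseteq> E" and dep: "C \<notin> column_matroid UNIV R E A"
    and min: "\<And>D. D \<subset> C \<Longrightarrow> D \<in> column_matroid UNIV R E A"
    using C by (auto simp: circuit_def)
  from dep sub obtain c e0 where c: "\<forall>e. e \<notin> C \<longrightarrow> c e = 0" "linear_relation R E A c" "c e0 \<noteq> 0"
    unfolding iff by blast
  have "c e \<noteq> 0" if "e \<in> C" for e
  proof
    assume "c e = 0"
    then have "\<forall>x. x \<notin> C - {e} \<longrightarrow> c x = 0" using c(1) by auto
    moreover have "C - {e} \<in> column_matroid UNIV R E A" using that by (intro min) auto
    ultimately have "c e0 = 0" using c(2) unfolding iff by blast
    with c(3) show False by simp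
  qed
  then show ?thesis using c(1,2) that by blast
qed

text \<open>The relations \<open>rel\<close> say that \<open>B\<close> spans. If \<open>B\<close>
  had a relation through \<open>y\<close>, already \<open>B - {y}\<close> would span, and the
  exchange bound fails for \<open>J\<close>.\<close>

lemma independent_if_card_eq:
  assumes fin: "finite E" and B: "B \<subseteq> E"
    and J: "J \<in> column_matroid UNIV R E A" "card J = card B"
    and rel: "\<And>x. x \<in> E - B \<Longrightarrow>
      \<exists>c. linear_relation R E A c \<and> (\<forall>e. e \<notin> insert x B \<longrightarrow> c e = 0) \<and> c x \<noteq> 0"
  shows "B \<in> column_matroid UNIV R E A"
proof (rule ccontr)
  assume "B \<notin> column_matroid UNIV R E A"
  then obtain b y where b: "\<forall>e. e \<notin> B \<longrightarrow> b e = 0" "linear_relation R E A b" "b y \<noteq> 0"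
    using B unfolding in_column_matroid_iff[OF fin UNIV_I] by blast
  then have y: "y \<in> B" by blast
  have JE: "J \<subseteq> E" using J(1) by (simp add: column_matroid_def)
  have "card J \<le> card (B - {y})"
  proof (rule card_le_of_spanned[OF subfield_set_UNIV J(1)])
    show "finite (B - {y})" "finite J" using fin B JE by (auto intro: finite_subset)
    fix x assume "x \<in> J"
    then have x: "x \<in> E" using JE by blast
    show "\<exists>d. (\<forall>e\<in>B - {y}. d e \<in> UNIV) \<and> (\<forall>r\<in>R. A r x = (\<Sum>e\<in>B - {y}. d e * A r e))"
    proof (cases "x \<in> B - {y}")
      case True
      then show ?thesis using fin B
        by (intro exI[of _ "\<lambda>e. if e = x then 1 else 0"])
           (auto simp: finite_subset if_distrib[of "\<lambda>u. u * _"] cong: if_cong)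
    next
      case False
      obtain c where c: "linear_relation R E A c" "\<forall>e. e \<notin> insert x B \<longrightarrow> c e = 0" "c x \<noteq> 0"
        and cy: "x \<noteq> y \<longrightarrow> c y = 0"
      proof (cases "x = y")
        case True
        then show ?thesis using that[of b] b y by auto
      next
        case xy: False
        then have xB: "x \<in> E - B" using False x by blast
        then obtain c where c: "linear_relation R E A c" "\<forall>e. e \<notin> insert x B \<longrightarrow> c e = 0" "c x \<noteq> 0"
          using rel by blast
        show ?thesis
        proof (rule that)
          \<comment> \<open>Cancels the coefficient at \<open>y\<close>. The one at \<open>x\<close>
            survives because \<open>b\<close> vanishes off \<open>B\<close>.\<close>
          show "linear_relation R E A (\<lambda>e. c e - c y / b y * b e)"
            by (intro linear_relation_diff linear_relation_cmult c b)
        qed (use c b xB in auto)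
      qed
      show ?thesis
      proof (intro exI conjI ballI)
        fix r assume "r \<in> R"
        have "0 = (\<Sum>e\<in>E. c e * A r e)" using c(1) \<open>r \<in> R\<close> by (simp add: linear_relation_def)
        also have "\<dots> = (\<Sum>e\<in>insert x (B - {y}). c e * A r e)"
          using fin B x c(2) cy by (intro sum.mono_neutral_right) auto
        also have "\<dots> = c x * A r x + (\<Sum>e\<in>B - {y}. c e * A r e)"
          using False fin B by (subst sum.insert) (auto intro: finite_subset)
        finally show "A r x = (\<Sum>e\<in>B - {y}. - c e / c x * A r e)"
          using c(3)
          by (simp add: field_simps sum_negf eq_neg_iff_add_eq_0 flip: sum_divide_distrib)
      qed simp
    qed
  qed
  also have "\<dots> < card B" using fin B y by (intro card_Diff1_less) (auto intro: finite_subset)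
  finally show False using J(2) by simp
qed

text \<open>Eliminating \<open>e1\<close> and \<open>e2\<close> from \<open>d\<close> by means of \<open>c1\<close> and \<open>c2\<close> leaves the zero relation. Hence
  \<open>c1\<close> and \<open>c2\<close> are proportional outside the support of \<open>d\<close>.\<close>

lemma relations_proportional:
  assumes fin: "finite E" and B: "B \<in> column_matroid UNIV R E A"
    and rel: "linear_relation R E A c1" "linear_relation R E A c2" "linear_relation R E A d"
    and e1: "c1 e1 \<noteq> 0" "c2 e1 = 0" "d e1 \<noteq> 0"
    and e2: "c1 e2 = 0" "c2 e2 \<noteq> 0" "d e2 \<noteq> 0"
    and supp: "\<And>e. e \<notin> B \<Longrightarrow> e \<noteq> e1 \<Longrightarrow> e \<noteq> e2 \<Longrightarrow> c1 e = 0 \<and> c2 e = 0 \<and> d e = 0"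
    and xy: "d x = 0" "d y = 0"
  shows "c1 x * c2 y = c2 x * (c1 y :: 'f::field)"
proof -
  define k1 where "k1 = d e1 / c1 e1"
  define k2 where "k2 = d e2 / c2 e2"
  define c where "c e = d e - k1 * c1 e - k2 * c2 e" for e
  have "linear_relation R E A c"
    unfolding c_def by (intro linear_relation_diff linear_relation_cmult rel)
  moreover have "c e = 0" if "e \<notin> B" for e
    using that supp[of e] e1 e2 by (cases "e = e1 \<or> e = e2") (auto simp: c_def k1_def k2_def)
  ultimately have 0: "c e = 0" for e
    using relation_supported_in_independent[OF fin B] by blast
  have nz: "k1 \<noteq> 0" "k2 \<noteq> 0" using e1 e2 by (auto simp: k1_def k2_def)
  have x: "k1 * c1 x = - (k2 * c2 x)" and y: "k1 * c1 y = - (k2 * c2 y)"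
    using 0[of x] 0[of y] xy by (simp_all add: c_def eq_neg_iff_add_eq_0 neg_eq_iff_add_eq_0)
  \<comment> \<open>Multiplying the equations at \<open>x\<close> and \<open>y\<close> crosswise
    avoids dividing by values of \<open>c1\<close> or \<open>c2\<close> there.\<close>
  have "k1 * k2 * (c1 x * c2 y) = (k1 * c1 x) * (k2 * c2 y)" by simp
  also have "\<dots> = (k2 * c2 x) * (k1 * c1 y)" unfolding x y by simp
  also have "\<dots> = k1 * k2 * (c2 x * c1 y)" by simp
  finally show ?thesis using nz by simp
qed

text \<open>The vectors \<open>standard_vector b \<psi> j\<close> are in reduced form, and \<open>kernel_vector b \<psi> j\<close>, for
  \<open>j \<in> {b<..n}\<close>, is the corresponding basis of their space of linear relations.\<close>

definition standard_vector :: "nat \<Rightarrow> (nat \<Rightarrow> nat \<Rightarrow> 'f) \<Rightarrow> nat \<Rightarrow> nat \<Rightarrow> 'f::field" where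
  "standard_vector b \<psi> j q = (if j \<le> b then if j = q then 1 else 0 else - \<psi> j q)"

definition kernel_vector :: "nat \<Rightarrow> (nat \<Rightarrow> nat \<Rightarrow> 'f) \<Rightarrow> nat \<Rightarrow> nat \<Rightarrow> 'f::field" where
  "kernel_vector b \<psi> j l = (if l \<le> b then \<psi> j l else if l = j then 1 else 0)"

text \<open>By \<open>row\<close>, the ratio of the entries at \<open>(p, q)\<close> and
  \<open>(p, j)\<close> does not depend on \<open>i\<close>; by \<open>col\<close>, that of
  \<open>(p, q)\<close> and \<open>(i, q)\<close> does not depend on \<open>j\<close>. Normalizing
  at \<open>(1, 1)\<close> separates the dependence on \<open>i\<close> from that on
  \<open>j\<close>, leaving a factor \<open>t\<close> of the cell alone.\<close>

lemma circuit_coefficients_factorize: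
  fixes c :: "nat \<Rightarrow> nat \<Rightarrow> nat \<times> nat \<Rightarrow> 'f::field"
  assumes ab: "1 \<le> a" "1 \<le> b" "a < m" "b < n"
    and supp: "\<And>i j e. i \<in> {a<..m} \<Longrightarrow> j \<in> {b<..n} \<Longrightarrow>
      c i j e \<noteq> 0 \<longleftrightarrow> e \<in> insert i {1..a} \<times> insert j {1..b}"
    and row: "\<And>i i' j p q. i \<in> {a<..m} \<Longrightarrow> i' \<in> {a<..m} \<Longrightarrow> j \<in> {b<..n} \<Longrightarrow> p \<in> {1..a} \<Longrightarrow>
      q \<in> {1..b} \<Longrightarrow> c i j (p, q) * c i' j (p, j) = c i' j (p, q) * c i j (p, j)"
    and col: "\<And>i j j' p q. i \<in> {a<..m} \<Longrightarrow> j \<in> {b<..n} \<Longrightarrow> j' \<in> {b<..n} \<Longrightarrow> p \<in> {1..a} \<Longrightarrow>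
      q \<in> {1..b} \<Longrightarrow> c i j (p, q) * c i j' (i, q) = c i j' (p, q) * c i j (i, q)"
  obtains t s \<phi> \<psi> where "\<And>k l. k \<in> {1..m} \<Longrightarrow> l \<in> {1..n} \<Longrightarrow> t (k, l) \<noteq> 0"
    and "\<And>i j k l. i \<in> {a<..m} \<Longrightarrow> j \<in> {b<..n} \<Longrightarrow> k \<in> {1..m} \<Longrightarrow> l \<in> {1..n} \<Longrightarrow>
      s i j * c i j (k, l) = t (k, l) * kernel_vector a \<phi> i k * kernel_vector b \<psi> j l"
proof -
  define i0 j0 where "i0 = Suc a" and "j0 = Suc b"
  have i0: "i0 \<in> {a<..m}" and j0: "j0 \<in> {b<..n}" and one: "1 \<in> {1..a}" "1 \<in> {1..b}"
    using ab by (auto simp: i0_def j0_def)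
  define W where "W i j = c i j (1, 1)" for i j
  \<comment> \<open>Normalized entries of \<open>c i j\<close>: \<open>F\<close> in column
    \<open>j\<close>, \<open>G\<close> in row \<open>i\<close>, and \<open>H\<close> in the block
    \<open>{1..a} \<times> {1..b}\<close>.\<close>
  define F where "F p i j = c i j (p, j) / W i j" for p i j
  define G where "G q i j = c i j (i, q) / W i j" for q i j
  define H where "H p q i j = c i j (p, q) / W i j" for p q i j
  define \<phi> where "\<phi> i p = H p 1 i j0" for i p
  define \<psi> where "\<psi> j q = H 1 q i0 j" for j q
  \<comment> \<open>What remains of an entry after removing its factors \<phi> and \<psi>. The
    reference indices \<open>i0\<close> and \<open>j0\<close> are harmless by the facts
    \<open>F\<close>, \<open>G\<close> and \<open>H\<close> below.\<close>
  define t where "t = (\<lambda>(k, l).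
    if k \<le> a then if l \<le> b then H k l i0 j0 / (\<phi> i0 k * \<psi> j0 l) else F k i0 l / \<phi> i0 k
    else if l \<le> b then G l k j0 / \<psi> j0 l else c k l (k, l) / W k l)"
  have W0: "W i j \<noteq> 0" if "i \<in> {a<..m}" "j \<in> {b<..n}" for i j
    unfolding W_def using that supp one by auto
  have F0: "F p i j \<noteq> 0" if "i \<in> {a<..m}" "j \<in> {b<..n}" "p \<in> {1..a}" for p i j
    unfolding F_def using that supp W0 by auto
  have G0: "G q i j \<noteq> 0" if "i \<in> {a<..m}" "j \<in> {b<..n}" "q \<in> {1..b}" for q i j
    unfolding G_def using that supp W0 by auto
  have H0: "H p q i j \<noteq> 0" if "i \<in> {a<..m}" "j \<in> {b<..n}" "p \<in> {1..a}" "q \<in> {1..b}" for p q i j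
    unfolding H_def using that supp W0 by auto
  have \<phi>0: "\<phi> i p \<noteq> 0" if "i \<in> {a<..m}" "p \<in> {1..a}" for i p
    unfolding \<phi>_def using that H0 j0 one by blast
  have \<psi>0: "\<psi> j q \<noteq> 0" if "j \<in> {b<..n}" "q \<in> {1..b}" for j q
    unfolding \<psi>_def using that H0 i0 one by blast
  have H1: "H 1 1 i j = 1" if "i \<in> {a<..m}" "j \<in> {b<..n}" for i j
    using W0[OF that] by (simp add: H_def W_def)
  have Hrow: "H p q i j * F p i' j = H p q i' j * F p i j"
    if "i \<in> {a<..m}" "i' \<in> {a<..m}" "j \<in> {b<..n}" "p \<in> {1..a}" "q \<in> {1..b}" for p q i i' j
    using row[OF that] by (simp add: H_def F_def mult.commute)
  have Hcol: "H p q i j * G q i j' = H p q i j' * G q i j"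
    if "i \<in> {a<..m}" "j \<in> {b<..n}" "j' \<in> {b<..n}" "p \<in> {1..a}" "q \<in> {1..b}" for p q i j j'
    using col[OF that] by (simp add: H_def G_def mult.commute)
  \<comment> \<open>In row 1 the case \<open>q = 1\<close> makes \<open>F 1 i j\<close> independent
    of \<open>i\<close>, and general \<open>q\<close> then transfers this to
    \<open>H 1 q i j\<close>.\<close>
  have \<psi>: "H 1 q i j = \<psi> j q" if "i \<in> {a<..m}" "j \<in> {b<..n}" "q \<in> {1..b}" for i j q
    using Hrow[OF that(1) i0 that(2) one(1) that(3)] Hrow[OF that(1) i0 that(2) one]
      H1[OF that(1,2)] H1[OF i0 that(2)] F0[OF that(1,2) one(1)] by (simp add: \<psi>_def)
  have \<phi>: "H p 1 i j = \<phi> i p" if "i \<in> {a<..m}" "j \<in> {b<..n}" "p \<in> {1..a}" for i j p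
    using Hcol[OF that(1,2) j0 that(3) one(2)] Hcol[OF that(1,2) j0 one]
      H1[OF that(1,2)] H1[OF that(1) j0] G0[OF that(1,2) one(2)] by (simp add: \<phi>_def)
  have F: "F p i j = F p i0 j / \<phi> i0 p * \<phi> i p"
    if "i \<in> {a<..m}" "j \<in> {b<..n}" "p \<in> {1..a}" for i j p
    using Hrow[OF that(1) i0 that(2,3) one(2)] \<phi>[OF that] \<phi>[OF i0 that(2,3)] \<phi>0[OF i0 that(3)]
    by (simp add: field_simps)
  have G: "G q i j = G q i j0 / \<psi> j0 q * \<psi> j q"
    if "i \<in> {a<..m}" "j \<in> {b<..n}" "q \<in> {1..b}" for i j q
    using Hcol[OF that(1,2) j0 one(1) that(3)] \<psi>[OF that] \<psi>[OF that(1) j0 that(3)] \<psi>0[OF j0 that(3)]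
    by (simp add: field_simps)
  \<comment> \<open>The block entries are brought to the reference indices one at a time: first
    \<open>i\<close> to \<open>i0\<close>, then \<open>j\<close> to \<open>j0\<close>.\<close>
  have Hi: "H p q i j = H p q i0 j * \<phi> i p / \<phi> i0 p"
    if "i \<in> {a<..m}" "j \<in> {b<..n}" "p \<in> {1..a}" "q \<in> {1..b}" for p q i j
    using Hrow[OF that(1) i0 that(2-4)] F[OF that(1-3)] F0[OF i0 that(2,3)] \<phi>0[OF i0 that(3)]
    by (simp add: field_simps)
  have Hj: "H p q i j = H p q i j0 * \<psi> j q / \<psi> j0 q"
    if "i \<in> {a<..m}" "j \<in> {b<..n}" "p \<in> {1..a}" "q \<in> {1..b}" for p q i j
    using Hcol[OF that(1,2) j0 that(3-4)] G[OF that(1,2,4)] G0[OF that(1) j0 that(4)] \<psi>0[OF j0 that(4)]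
    by (simp add: field_simps)
  have H: "H p q i j = H p q i0 j0 / (\<phi> i0 p * \<psi> j0 q) * \<phi> i p * \<psi> j q"
    if "i \<in> {a<..m}" "j \<in> {b<..n}" "p \<in> {1..a}" "q \<in> {1..b}" for p q i j
    using Hi[OF that] Hj[OF i0 that(2-4)] by (simp add: mult_ac)
  show ?thesis
  proof (rule that)
    show "t (k, l) \<noteq> 0" if "k \<in> {1..m}" "l \<in> {1..n}" for k l
      using that F0 G0 H0 W0 \<phi>0 \<psi>0 i0 j0 supp by (auto simp: t_def)
    show "1 / W i j * c i j (k, l) = t (k, l) * kernel_vector a \<phi> i k * kernel_vector b \<psi> j l"
      if ij: "i \<in> {a<..m}" "j \<in> {b<..n}" and kl: "k \<in> {1..m}" "l \<in> {1..n}" for i j k l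
    proof (cases "(k, l) \<in> insert i {1..a} \<times> insert j {1..b}")
      case False
      then show ?thesis using supp[OF ij, of "(k, l)"] kl by (auto simp: kernel_vector_def)
    next
      case True
      then consider "k = i" "l = j" | "k = i" "l \<in> {1..b}" | "k \<in> {1..a}" "l = j"
        | "k \<in> {1..a}" "l \<in> {1..b}" by blast
      then show ?thesis
      proof cases
        case 1
        then show ?thesis using ij by (simp add: kernel_vector_def t_def)
      next
        case 2
        then show ?thesis using ij G[OF ij 2(2)] by (simp add: kernel_vector_def t_def G_def)
      next
        case 3
        then show ?thesis using ij F[OF ij 3(1)] by (simp add: kernel_vector_def t_def F_def)
      next
        case 4
        then show ?thesis using H[OF ij 4] by (simp add: kernel_vector_def t_def H_def)
      qed
    qed
  qed
qed

section \<open>Column scaling and tensor product kernels\<close>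

lemma column_matroid_eq_if_scaled:
  fixes A :: "'r \<Rightarrow> 'e \<Rightarrow> 'f::field" and A' :: "'s \<Rightarrow> 'e \<Rightarrow> 'f"
  assumes fin: "finite E" and t: "\<And>e. t e \<noteq> 0"
    and rel: "\<And>x. linear_relation R E A x \<longleftrightarrow> linear_relation R' E A' (\<lambda>e. x e / t e)"
  shows "column_matroid UNIV R E A = column_matroid UNIV R' E A'"
proof (intro set_eqI iffI)
  fix I assume I: "I \<in> column_matroid UNIV R E A"
  show "I \<in> column_matroid UNIV R' E A'"
  proof (rule in_column_matroidI[OF fin])
    show "I \<subseteq> E" using I by (simp add: column_matroid_def)
    fix y e assume y: "\<And>e. e \<notin> I \<Longrightarrow> y e = 0" "linear_relation R' E A' y"
    \<comment> \<open>Multiplication by the nowhere zero \<open>t\<close> inverts the correspondence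
      of relations and preserves supports.\<close>
    have "linear_relation R E A (\<lambda>e. y e * t e)" using rel y(2) t by simp
    then have "y e * t e = 0"
      by (rule relation_supported_in_independent[OF fin I, rotated]) (simp add: y(1))
    then show "y e = 0" using t by simp
  qed
next
  fix I assume I: "I \<in> column_matroid UNIV R' E A'"
  show "I \<in> column_matroid UNIV R E A"
  proof (rule in_column_matroidI[OF fin])
    show "I \<subseteq> E" using I by (simp add: column_matroid_def)
    fix x e assume x: "\<And>e. e \<notin> I \<Longrightarrow> x e = 0" "linear_relation R E A x"
    have "linear_relation R' E A' (\<lambda>e. x e / t e)" using rel x(2) by simp
    then have "x e / t e = 0"
      by (rule relation_supported_in_independent[OF fin I, rotated]) (simp add: x(1))
    then show "x e = 0" using t by simp
  qed
qed

text \<open>The unit vectors make each of the first \<open>b\<close> coordinates of \<open>f\<close>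
  a combination of the free coordinates \<open>j > b\<close>. For \<open>l > b\<close> the equation
  on the right is trivial.\<close>

lemma standard_vector_relation_iff:
  assumes "b \<le> n"
  shows "(\<forall>q\<in>{1..b}. (\<Sum>j\<in>{1..n}. f j * standard_vector b \<psi> j q) = 0) \<longleftrightarrow>
    (\<forall>l\<in>{1..n}. f l = (\<Sum>j\<in>{b<..n}. f j * kernel_vector b \<psi> j l))"
proof -
  have low: "(\<Sum>j\<in>{1..n}. f j * standard_vector b \<psi> j q)
      = f q - (\<Sum>j\<in>{b<..n}. f j * kernel_vector b \<psi> j q)" if "q \<in> {1..b}" for q
  proof -
    have union: "{1..n} = {1..b} \<union> {b<..n}" using assms by auto
    have "(\<Sum>j\<in>{1..n}. f j * standard_vector b \<psi> j q)
        = (\<Sum>j\<in>{1..b}. f j * standard_vector b \<psi> j q)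
          + (\<Sum>j\<in>{b<..n}. f j * standard_vector b \<psi> j q)"
      unfolding union by (rule sum.union_disjoint) auto
    moreover have "(\<Sum>j\<in>{1..b}. f j * standard_vector b \<psi> j q) = (\<Sum>j\<in>{1..b}. if j = q then f j else 0)"
      by (intro sum.cong) (auto simp: standard_vector_def)
    moreover have "(\<Sum>j\<in>{b<..n}. f j * standard_vector b \<psi> j q)
        = - (\<Sum>j\<in>{b<..n}. f j * kernel_vector b \<psi> j q)"
      unfolding sum_negf[symmetric] using that
      by (intro sum.cong) (auto simp: standard_vector_def kernel_vector_def)
    ultimately show ?thesis using that by simp
  qed
  have high: "(\<Sum>j\<in>{b<..n}. f j * kernel_vector b \<psi> j l) = f l" if "l \<in> {b<..n}" for l
  proof -
    have "(\<Sum>j\<in>{b<..n}. f j * kernel_vector b \<psi> j l) = (\<Sum>j\<in>{b<..n}. if l = j then f j else 0)"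
      using that by (intro sum.cong) (auto simp: kernel_vector_def)
    then show ?thesis using that by simp
  qed
  have split: "(\<forall>l\<in>{1..n}. P l) \<longleftrightarrow> (\<forall>l\<in>{1..b}. P l) \<and> (\<forall>l\<in>{b<..n}. P l)" for P
    using assms by force
  show ?thesis unfolding split using low high by auto
qed

text \<open>With \<open>l\<close> in \<open>J\<close> or \<open>k\<close> in \<open>I\<close>, one
  sum of the double expansion collapses, which gives the single expansions on those slices;
  substituting them back gives both in general. Conversely, expand along \<open>Y\<close> first and
  then along \<open>X\<close>.\<close>

lemma kernel_tensor_iff:
  fixes y :: "'x \<times> 'y \<Rightarrow> 'f::field"
  assumes IJ: "finite I" "finite J" "I \<subseteq> X" "J \<subseteq> Y"
    and \<alpha>: "\<And>i k. i \<in> I \<Longrightarrow> k \<in> I \<Longrightarrow> \<alpha> i k = (if k = i then 1 else 0)"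
    and \<beta>: "\<And>j l. j \<in> J \<Longrightarrow> l \<in> J \<Longrightarrow> \<beta> j l = (if l = j then 1 else 0)"
  shows "(\<forall>k\<in>X. \<forall>l\<in>Y. y (k, l) = (\<Sum>i\<in>I. \<Sum>j\<in>J. y (i, j) * \<alpha> i k * \<beta> j l)) \<longleftrightarrow>
    (\<forall>k\<in>X. \<forall>l\<in>Y. y (k, l) = (\<Sum>j\<in>J. y (k, j) * \<beta> j l)) \<and>
    (\<forall>l\<in>Y. \<forall>k\<in>X. y (k, l) = (\<Sum>i\<in>I. y (i, l) * \<alpha> i k))" (is "?T \<longleftrightarrow> ?B \<and> ?A")
proof
  assume T: ?T
  have \<beta>J: "(\<Sum>j\<in>J. f j * \<beta> j l) = f l" if "l \<in> J" for f l
  proof -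
    have "(\<Sum>j\<in>J. f j * \<beta> j l) = (\<Sum>j\<in>J. if l = j then f j else 0)"
      using that \<beta> by (intro sum.cong) auto
    then show ?thesis using that IJ by simp
  qed
  have \<alpha>I: "(\<Sum>i\<in>I. f i * \<alpha> i k) = f k" if "k \<in> I" for f k
  proof -
    have "(\<Sum>i\<in>I. f i * \<alpha> i k) = (\<Sum>i\<in>I. if k = i then f i else 0)"
      using that \<alpha> by (intro sum.cong) auto
    then show ?thesis using that IJ by simp
  qed
  have yJ: "y (k, j) = (\<Sum>i\<in>I. y (i, j) * \<alpha> i k)" if "k \<in> X" "j \<in> J" for k j
    using T that IJ \<beta>J[OF that(2)] by (simp add: subset_iff)
  have yI: "y (i, l) = (\<Sum>j\<in>J. y (i, j) * \<beta> j l)" if "i \<in> I" "l \<in> Y" for i l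
  proof -
    have "y (i, l) = (\<Sum>i'\<in>I. \<Sum>j\<in>J. y (i', j) * \<alpha> i' i * \<beta> j l)"
      using T that IJ by blast
    also have "\<dots> = (\<Sum>i'\<in>I. (\<Sum>j\<in>J. y (i', j) * \<beta> j l) * \<alpha> i' i)"
      unfolding sum_distrib_right by (intro sum.cong refl) (simp add: mult_ac)
    finally show ?thesis using \<alpha>I[OF that(1)] by simp
  qed
  show "?B \<and> ?A"
  proof (intro conjI ballI)
    fix k l assume kl: "k \<in> X" "l \<in> Y"
    have "y (k, l) = (\<Sum>i\<in>I. \<Sum>j\<in>J. y (i, j) * \<alpha> i k * \<beta> j l)" using T kl by blast
    also have "\<dots> = (\<Sum>j\<in>J. (\<Sum>i\<in>I. y (i, j) * \<alpha> i k) * \<beta> j l)"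
      by (subst sum.swap) (simp add: sum_distrib_right)
    also have "\<dots> = (\<Sum>j\<in>J. y (k, j) * \<beta> j l)"
      using yJ kl by (intro sum.cong) simp_all
    finally show "y (k, l) = (\<Sum>j\<in>J. y (k, j) * \<beta> j l)" .
  next
    fix k l assume kl: "l \<in> Y" "k \<in> X"
    have "y (k, l) = (\<Sum>i\<in>I. \<Sum>j\<in>J. y (i, j) * \<alpha> i k * \<beta> j l)" using T kl by blast
    also have "\<dots> = (\<Sum>i\<in>I. (\<Sum>j\<in>J. y (i, j) * \<beta> j l) * \<alpha> i k)"
      unfolding sum_distrib_right by (intro sum.cong refl) (simp add: mult_ac)
    also have "\<dots> = (\<Sum>i\<in>I. y (i, l) * \<alpha> i k)"
      using yI kl by (intro sum.cong) simp_all
    finally show "y (k, l) = (\<Sum>i\<in>I. y (i, l) * \<alpha> i k)" .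
  qed
next
  assume BA: "?B \<and> ?A"
  show ?T
  proof (intro ballI)
    fix k l assume kl: "k \<in> X" "l \<in> Y"
    have "y (k, l) = (\<Sum>j\<in>J. y (k, j) * \<beta> j l)" using BA kl by blast
    also have "\<dots> = (\<Sum>j\<in>J. (\<Sum>i\<in>I. y (i, j) * \<alpha> i k) * \<beta> j l)"
    proof (rule sum.cong[OF refl])
      fix j assume "j \<in> J"
      then have "y (k, j) = (\<Sum>i\<in>I. y (i, j) * \<alpha> i k)" using BA kl IJ by blast
      then show "y (k, j) * \<beta> j l = (\<Sum>i\<in>I. y (i, j) * \<alpha> i k) * \<beta> j l" by (rule arg_cong)
    qed
    also have "\<dots> = (\<Sum>i\<in>I. \<Sum>j\<in>J. y (i, j) * \<alpha> i k * \<beta> j l)"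
      by (subst sum.swap) (simp add: sum_distrib_right)
    finally show "y (k, l) = (\<Sum>i\<in>I. \<Sum>j\<in>J. y (i, j) * \<alpha> i k * \<beta> j l)" .
  qed
qed

text \<open>Products of kernel vectors span the kernel, and the entries of \<open>y\<close> on
  \<open>{a<..m} \<times> {b<..n}\<close> are its coefficients.\<close>

lemma linear_relation_standard_iff:
  assumes "a \<le> m" and "b \<le> n"
  shows "linear_relation (birigidity_rows a b m n) (bigraph_edges m n)
      (birigidity_matrix (standard_vector a \<phi>) (standard_vector b \<psi>)) y \<longleftrightarrow>
    (\<forall>k\<in>{1..m}. \<forall>l\<in>{1..n}. y (k, l) =
      (\<Sum>i\<in>{a<..m}. \<Sum>j\<in>{b<..n}. y (i, j) * kernel_vector a \<phi> i k * kernel_vector b \<psi> j l))"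
  unfolding linear_relation_birigidity_iff
    standard_vector_relation_iff[OF assms(1)] standard_vector_relation_iff[OF assms(2)]
  by (rule kernel_tensor_iff[symmetric]) (auto simp: kernel_vector_def)

lemma abstract_birigidity_standard_representation:
  fixes M :: "(nat \<times> nat) set set"
  assumes ab: "1 \<le> a" "1 \<le> b" "a < m" "b < n"
    and M: "abstract_birigidity a b m n M"
    and rep: "representable_over (UNIV :: 'f::field set) (bigraph_edges m n) M"
  shows "\<exists>(u :: nat \<Rightarrow> nat \<Rightarrow> 'f) v. M = birigidity_column_matroid UNIV a b m n u v"
proof -
  let ?E = "bigraph_edges m n"
  let ?B = "hook_edges a b m n"
  have fin: "finite ?E" by simp
  obtain N :: nat and A :: "nat \<Rightarrow> nat \<times> nat \<Rightarrow> 'f" where A: "M = column_matroid UNIV {..<N} ?E A"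
    using rep unfolding representable_over_def by blast
  let ?rel = "linear_relation {..<N} ?E A"
  have circ: "\<exists>c. ?rel c \<and> (\<forall>e. c e \<noteq> 0 \<longleftrightarrow> e \<in> X \<times> Y)"
    if "X \<subseteq> {1..m}" "Y \<subseteq> {1..n}" "card X = a + 1" "card Y = b + 1" for X Y
  proof -
    have "circuit ?E M (X \<times> Y)" using M that by (simp add: abstract_birigidity_def)
    then show ?thesis using circuit_linear_relation[OF _ fin] unfolding A by metis
  qed
  \<comment> \<open>Relation of the fundamental circuit of \<open>(i, j)\<close>, which is the only
    cell of this biclique outside the hook.\<close>
  define c where "c i j = (SOME c. ?rel c \<and> (\<forall>e. c e \<noteq> 0 \<longleftrightarrow> e \<in> insert i {1..a} \<times> insert j {1..b}))"
    for i j
  have c: "?rel (c i j) \<and> (\<forall>e. c i j e \<noteq> 0 \<longleftrightarrow> e \<in> insert i {1..a} \<times> insert j {1..b})"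
    if "i \<in> {a<..m}" "j \<in> {b<..n}" for i j
  proof -
    have "\<exists>c. ?rel c \<and> (\<forall>e. c e \<noteq> 0 \<longleftrightarrow> e \<in> insert i {1..a} \<times> insert j {1..b})"
      by (rule circ) (use that ab in auto)
    then show ?thesis unfolding c_def by (rule someI_ex)
  qed
  have crel: "?rel (c i j)" if "i \<in> {a<..m}" "j \<in> {b<..n}" for i j
    using c[OF that] by blast
  have csupp: "c i j e \<noteq> 0 \<longleftrightarrow> e \<in> insert i {1..a} \<times> insert j {1..b}"
    if "i \<in> {a<..m}" "j \<in> {b<..n}" for i j e
    using c[OF that] by blast
  have csupp0: "c i j e = 0 \<longleftrightarrow> e \<notin> insert i {1..a} \<times> insert j {1..b}"
    if "i \<in> {a<..m}" "j \<in> {b<..n}" for i j e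
    using csupp[OF that] by blast
  have hook: "?B \<in> column_matroid UNIV {..<N} ?E A"
  proof -
    have "M \<subseteq> Pow ?E" "{} \<in> M"
      using M by (auto simp: abstract_birigidity_def matroid_def)
    then have "finite M" "M \<noteq> {}" using finite_subset[of M "Pow ?E"] fin by blast+
    then have "matroid_rank M \<in> card ` M" unfolding matroid_rank_def by (intro Max_in) auto
    then obtain J where J: "J \<in> M" "card J = matroid_rank M" by auto
    \<comment> \<open>The rank condition enters here: some independent set has the size of the
      hook.\<close>
    have "int (card J) = int (card ?B)"
      using M J(2) card_hook_edges[of a m b n] ab by (simp add: abstract_birigidity_def)
    then have card: "card J = card ?B" by simp
    show ?thesis
    proof (rule independent_if_card_eq[OF fin _ J(1)[unfolded A] card])
      show "?B \<subseteq> ?E" by (auto simp: hook_edges_def)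
      fix x assume "x \<in> ?E - ?B"
      then obtain i j where x: "x = (i, j)" and ij: "i \<in> {a<..m}" "j \<in> {b<..n}"
        by (auto simp: hook_edges_def)
      have "insert i {1..a} \<times> insert j {1..b} \<subseteq> insert x ?B"
        using ij ab by (auto simp: hook_edges_def x)
      then show "\<exists>c. ?rel c \<and> (\<forall>e. e \<notin> insert x ?B \<longrightarrow> c e = 0) \<and> c x \<noteq> 0"
        using crel[OF ij] csupp[OF ij] x by (intro exI[of _ "c i j"]) blast
    qed
  qed
  have row: "c i j (p, q) * c i' j (p, j) = c i' j (p, q) * c i j (p, j)"
    if ij: "i \<in> {a<..m}" "i' \<in> {a<..m}" "j \<in> {b<..n}" and pq: "p \<in> {1..a}" "q \<in> {1..b}" for i i' j p q
  proof (cases "i = i'")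
    case False
    \<comment> \<open>Row \<open>p\<close> is exchanged for \<open>i'\<close>. The circuit avoids
      row \<open>p\<close>, so \<open>d\<close> vanishes at \<open>(p, q)\<close> and
      \<open>(p, j)\<close>, while its only cells off the hook are \<open>(i, j)\<close> and
      \<open>(i', j)\<close>.\<close>
    let ?X = "insert i (insert i' ({1..a} - {p}))" and ?Y = "insert j {1..b}"
    have XY: "?X \<subseteq> {1..m}" "?Y \<subseteq> {1..n}" "card ?X = a + 1" "card ?Y = b + 1"
      using ij pq ab False by auto
    obtain d where d: "?rel d" "\<And>e. d e \<noteq> 0 \<longleftrightarrow> e \<in> ?X \<times> ?Y"
      using circ[OF XY] by blast
    have d0: "d e = 0 \<longleftrightarrow> e \<notin> ?X \<times> ?Y" for e
      using d(2) by blast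
    show ?thesis
    proof (rule relations_proportional[OF fin hook crel[OF ij(1,3)] crel[OF ij(2,3)] d(1),
          of "(i, j)" "(i', j)"])
      show "c i j e = 0 \<and> c i' j e = 0 \<and> d e = 0"
        if "e \<notin> ?B" "e \<noteq> (i, j)" "e \<noteq> (i', j)" for e
        using that ij pq ab unfolding csupp0[OF ij(1,3)] csupp0[OF ij(2,3)] d0
        by (cases e) (auto simp: hook_edges_def)
    qed (use ij pq False in \<open>auto simp: csupp0 d0\<close>)
  qed simp
  have col: "c i j (p, q) * c i j' (i, q) = c i j' (p, q) * c i j (i, q)"
    if ij: "i \<in> {a<..m}" "j \<in> {b<..n}" "j' \<in> {b<..n}" and pq: "p \<in> {1..a}" "q \<in> {1..b}" for i j j' p q
  proof (cases "j = j'")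
    case False
    let ?X = "insert i {1..a}" and ?Y = "insert j (insert j' ({1..b} - {q}))"
    have XY: "?X \<subseteq> {1..m}" "?Y \<subseteq> {1..n}" "card ?X = a + 1" "card ?Y = b + 1"
      using ij pq ab False by auto
    obtain d where d: "?rel d" "\<And>e. d e \<noteq> 0 \<longleftrightarrow> e \<in> ?X \<times> ?Y"
      using circ[OF XY] by blast
    have d0: "d e = 0 \<longleftrightarrow> e \<notin> ?X \<times> ?Y" for e
      using d(2) by blast
    show ?thesis
    proof (rule relations_proportional[OF fin hook crel[OF ij(1,2)] crel[OF ij(1,3)] d(1),
          of "(i, j)" "(i, j')"])
      show "c i j e = 0 \<and> c i j' e = 0 \<and> d e = 0"
        if "e \<notin> ?B" "e \<noteq> (i, j)" "e \<noteq> (i, j')" for e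
        using that ij pq ab unfolding csupp0[OF ij(1,2)] csupp0[OF ij(1,3)] d0
        by (cases e) (auto simp: hook_edges_def)
    qed (use ij pq False in \<open>auto simp: csupp0 d0\<close>)
  qed simp
  obtain t s \<phi> \<psi> where t: "\<And>k l. k \<in> {1..m} \<Longrightarrow> l \<in> {1..n} \<Longrightarrow> t (k, l) \<noteq> 0"
    and st: "\<And>i j k l. i \<in> {a<..m} \<Longrightarrow> j \<in> {b<..n} \<Longrightarrow> k \<in> {1..m} \<Longrightarrow> l \<in> {1..n} \<Longrightarrow>
      s i j * c i j (k, l) = t (k, l) * kernel_vector a \<phi> i k * kernel_vector b \<psi> j l"
    by (rule circuit_coefficients_factorize[OF ab csupp row col]; (rule that)?)
  \<comment> \<open>The value 1 outside the ground set makes the scaling nonzero everywhere.\<close>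
  define t' where "t' e = (if e \<in> ?E then t e else 1)" for e
  have t': "t' e \<noteq> 0" for e
    using t[of "fst e" "snd e"] by (cases e) (simp add: t'_def)
  let ?u = "standard_vector a \<phi>" and ?v = "standard_vector b \<psi>"
  have "?rel x \<longleftrightarrow> linear_relation (birigidity_rows a b m n) ?E (birigidity_matrix ?u ?v) (\<lambda>e. x e / t' e)"
    for x
  proof -
    define y where "y e = x e / t' e" for e
    \<comment> \<open>The combination of circuit relations built to agree with \<open>x\<close> off
      the hook; after division by \<open>t'\<close> it is the tensor expansion \<open>w\<close> of
      \<open>y\<close>.\<close>
    define z where "z = (\<lambda>e. \<Sum>i\<in>{a<..m}. \<Sum>j\<in>{b<..n}. y (i, j) * s i j * c i j e)"
    define w where "w k l = (\<Sum>i\<in>{a<..m}. \<Sum>j\<in>{b<..n}.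
      y (i, j) * kernel_vector a \<phi> i k * kernel_vector b \<psi> j l)" for k l
    have x: "x e = t' e * y e" for e using t' by (simp add: y_def)
    have z: "z (k, l) = t' (k, l) * w k l" if "k \<in> {1..m}" "l \<in> {1..n}" for k l
    proof -
      have eq: "y (i, j) * s i j * c i j (k, l)
          = t' (k, l) * (y (i, j) * kernel_vector a \<phi> i k * kernel_vector b \<psi> j l)"
        if "i \<in> {a<..m}" "j \<in> {b<..n}" for i j
        using st[OF that \<open>k \<in> _\<close> \<open>l \<in> _\<close>] \<open>k \<in> _\<close> \<open>l \<in> _\<close> by (simp add: t'_def mult_ac)
      show ?thesis unfolding z_def w_def sum_distrib_left by (intro sum.cong refl eq)
    qed
    have zrel: "?rel z"
      unfolding z_def by (intro linear_relation_sum linear_relation_cmult crel)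
    have "?rel x \<longleftrightarrow> (\<forall>k\<in>{1..m}. \<forall>l\<in>{1..n}. y (k, l) = w k l)"
    proof
      assume "\<forall>k\<in>{1..m}. \<forall>l\<in>{1..n}. y (k, l) = w k l"
      then have "x e = z e" if "e \<in> ?E" for e using that z x by (cases e) auto
      then show "?rel x" using zrel linear_relation_cong by blast
    next
      assume "?rel x"
      \<comment> \<open>Cut off outside the ground set, so that \<open>r\<close> vanishes everywhere
        off the independent hook and must be zero.\<close>
      define r where "r e = (if e \<in> ?E then x e - z e else 0)" for e
      have "?rel (\<lambda>e. x e - z e)" by (intro linear_relation_diff zrel \<open>?rel x\<close>)
      then have "?rel r" by (rule iffD1[OF linear_relation_cong, rotated]) (simp add: r_def)
      moreover have "r e = 0" if eB: "e \<notin> ?B" for e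
      proof (cases "e \<in> ?E")
        case True
        then obtain k l where e: "e = (k, l)" "k \<in> {a<..m}" "l \<in> {b<..n}"
          using eB True by (auto simp: hook_edges_def)
        \<comment> \<open>Off the hook both kernel vectors are Kronecker deltas, so the expansion
          returns the coefficient \<open>y (k, l)\<close>.\<close>
        have "w k l = (\<Sum>i\<in>{a<..m}. \<Sum>j\<in>{b<..n}. if l = j then if k = i then y (i, j) else 0 else 0)"
          unfolding w_def using e by (intro sum.cong) (auto simp: kernel_vector_def)
        also have "\<dots> = y (k, l)" using e by simp
        finally show ?thesis using z[of k l] x[of e] e by (simp add: r_def)
      qed (simp add: r_def)
      ultimately have r0: "r e = 0" for e
        using relation_supported_in_independent[OF fin hook] by blast
      show "\<forall>k\<in>{1..m}. \<forall>l\<in>{1..n}. y (k, l) = w k l"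
      proof (intro ballI)
        fix k l assume kl: "k \<in> {1..m}" "l \<in> {1..n}"
        then have "x (k, l) = z (k, l)" using r0[of "(k, l)"] by (simp add: r_def)
        then show "y (k, l) = w k l" using x[of "(k, l)"] z[OF kl] t'[of "(k, l)"] by simp
      qed
    qed
    then show ?thesis
      using linear_relation_standard_iff[of a m b n \<phi> \<psi> y] ab unfolding y_def w_def by simp
  qed
  then have "M = birigidity_column_matroid UNIV a b m n ?u ?v"
    unfolding A birigidity_column_matroid_def by (rule column_matroid_eq_if_scaled[OF fin t'])
  then show ?thesis by blast
qed

theorem theorem1p2:
  fixes a b m n :: nat
  assumes "a \<ge> 2" and "b \<ge> 2" and "m \<ge> a + 1" and "n \<ge> b + 1"
  shows
    "abstract_birigidity a b m n (generic_birigidity_matroid a b m n) \<and>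
     representable_over (generic_field a b m n) (bigraph_edges m n)
       (generic_birigidity_matroid a b m n) \<and>
     (\<forall>M. abstract_birigidity a b m n M \<and>
          representable_over (UNIV :: 'f::field set) (bigraph_edges m n) M \<longrightarrow>
          M \<preceq> generic_birigidity_matroid a b m n) \<and>
     (\<forall>M. abstract_birigidity a b m n M \<and>
          representable_over (UNIV :: 'f set) (bigraph_edges m n) M \<longrightarrow>
          (\<exists>(u :: nat \<Rightarrow> nat \<Rightarrow> 'f) (v :: nat \<Rightarrow> nat \<Rightarrow> 'f).
             M = birigidity_column_matroid UNIV a b m n u v))"
proof -
  have std: "\<exists>(u :: nat \<Rightarrow> nat \<Rightarrow> 'f) v. M = birigidity_column_matroid UNIV a b m n u v"
    if "abstract_birigidity a b m n M \<and> representable_over (UNIV :: 'f set) (bigraph_edges m n) M" for M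
    using that assms by (intro abstract_birigidity_standard_representation) auto
  have "M \<preceq> generic_birigidity_matroid a b m n"
    if M: "abstract_birigidity a b m n M \<and> representable_over (UNIV :: 'f set) (bigraph_edges m n) M" for M
    using std[OF M] generic_birigidity_matroid_if_specialized unfolding weak_order_def by blast
  moreover have "abstract_birigidity a b m n (generic_birigidity_matroid a b m n)"
    using assms by (intro abstract_birigidity_generic) auto
  ultimately show ?thesis using std representable_over_generic by simp
qed

end
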